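(* Let $\mathcal{C}$ be a prevariety of languages over a finite alphabet $A$. Then $\mathit{SD}(\mathcal{C}) = \mathit{SF}(\mathcal{C})$.
   Context: Fix a finite alphabet $A$; $A^*$ is the set of finite words (with empty word $\varepsilon$), $A^+=A^*\setminus\{\varepsilon\}$, and a language is a subset of $A^*$. A class is a set of languages. A prevariety is a class $\mathcal{C}$ of regular languages containing $\emptyset$ and $A^*$, closed under union, intersection and complement, and closed under quotients: for all $L\in\mathcal{C}$ and $u\in A^*$, the languages $u^{-1}L=\{w \mid uw\in L\}$ and $Lu^{-1}=\{w\mid wu\in L\}$ belong to $\mathcal{C}$. The star-free closure $\mathit{SF}(\mathcal{C})$ is the least class containing $\mathcal{C}$ and all singletons $\{a\}$ for $a\in A$, and closed under union, complement ($K\mapsto A^*\setminus K$) and concatenation ($KL=\{uv\mid u\in K, v\in L\}$). A prefix code is a language $K\subseteq A^+$ with $K\cap KA^+=\emptyset$. For an integer $d\ge 1$, a prefix code $K$ has synchronization delay $d$ if for all $u,v,w\in A^*$, $uvw\in K^+$ and $v\in K^d$ imply $uv\in K^+$; it has bounded synchronization delay if it has synchronization delay $d$ for some $d\ge1$. A concatenation $KL$ is unambiguous if whenever $u,u'\in K$, $v,v'\in L$ and $uv=u'v'$, then $u=u'$ and $v=v'$. $\mathit{SD}(\mathcal{C})$ is the least class containing $\emptyset$ and $\{a\}$ for every $a\in A$, and closed under: intersection with languages of $\mathcal{C}$ (if $K\in\mathit{SD}(\mathcal{C})$ and $L\in\mathcal{C}$ then $K\cap L\in\mathit{SD}(\mathcal{C})$);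 union of disjoint languages; unambiguous concatenation; and Kleene star $K^*$ of languages $K\in\mathit{SD}(\mathcal{C})$ that are prefix codes of bounded synchronization delay. *)

theory Defs
  imports Main
begin

text \<open>Words over the finite alphabet (the type 'a, of class finite) are lists;
  a language is a set of lists. The alphabet A is UNIV :: 'a set, so A^* is UNIV.\<close>

definition conc :: "'a list set \<Rightarrow> 'a list set \<Rightarrow> 'a list set" (infixr "@@" 75) where
  "K @@ L = {u @ v | u v. u \<in> K \<and> v \<in> L}"

fun lpow :: "'a list set \<Rightarrow> nat \<Rightarrow> 'a list set" where
  "lpow K 0 = {[]}"
| "lpow K (Suc n) = K @@ lpow K n"

definition lstar :: "'a list set \<Rightarrow> 'a list set" where
  "lstar K = (\<Union>n. lpow K n)"

definition lplus :: "'a list set \<Rightarrow> 'a list set" where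
  "lplus K = (\<Union>n\<in>{1..}. lpow K n)"

inductive regular :: "'a list set \<Rightarrow> bool" where
  reg_empty: "regular {}"
| reg_eps: "regular {[]}"
| reg_letter: "regular {[a]}"
| reg_union: "regular K \<Longrightarrow> regular L \<Longrightarrow> regular (K \<union> L)"
| reg_conc: "regular K \<Longrightarrow> regular L \<Longrightarrow> regular (K @@ L)"
| reg_star: "regular K \<Longrightarrow> regular (lstar K)"

definition lquot :: "'a list \<Rightarrow> 'a list set \<Rightarrow> 'a list set" where
  "lquot u L = {w. u @ w \<in> L}"

definition rquot :: "'a list set \<Rightarrow> 'a list \<Rightarrow> 'a list set" where
  "rquot L u = {w. w @ u \<in> L}"

definition prevariety :: "('a::finite) list set set \<Rightarrow> bool" where
  "prevariety C \<longleftrightarrow>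
     (\<forall>L\<in>C. regular L) \<and> {} \<in> C \<and> UNIV \<in> C \<and>
     (\<forall>K\<in>C. \<forall>L\<in>C. K \<union> L \<in> C) \<and>
     (\<forall>K\<in>C. \<forall>L\<in>C. K \<inter> L \<in> C) \<and>
     (\<forall>L\<in>C. - L \<in> C) \<and>
     (\<forall>L\<in>C. \<forall>u. lquot u L \<in> C \<and> rquot L u \<in> C)"

inductive_set SF :: "('a::finite) list set set \<Rightarrow> 'a list set set" for C where
  SF_base: "L \<in> C \<Longrightarrow> L \<in> SF C"
| SF_letter: "{[a]} \<in> SF C"
| SF_union: "K \<in> SF C \<Longrightarrow> L \<in> SF C \<Longrightarrow> K \<union> L \<in> SF C"
| SF_compl: "K \<in> SF C \<Longrightarrow> - K \<in> SF C"
| SF_conc: "K \<in> SF C \<Longrightarrow> L \<in> SF C \<Longrightarrow> K @@ L \<in> SF C"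

definition prefix_code :: "'a list set \<Rightarrow> bool" where
  "prefix_code K \<longleftrightarrow> [] \<notin> K \<and> K \<inter> (K @@ (UNIV - {[]})) = {}"

definition sync_delay :: "'a list set \<Rightarrow> nat \<Rightarrow> bool" where
  "sync_delay K d \<longleftrightarrow> prefix_code K \<and> d \<ge> 1 \<and>
     (\<forall>u v w. u @ v @ w \<in> lplus K \<and> v \<in> lpow K d \<longrightarrow> u @ v \<in> lplus K)"

definition bounded_sync_delay :: "'a list set \<Rightarrow> bool" where
  "bounded_sync_delay K \<longleftrightarrow> (\<exists>d\<ge>1. sync_delay K d)"

definition unambiguous :: "'a list set \<Rightarrow> 'a list set \<Rightarrow> bool" where
  "unambiguous K L \<longleftrightarrow>
     (\<forall>u\<in>K. \<forall>u'\<in>K. \<forall>v\<in>L. \<forall>v'\<in>L. u @ v = u' @ v' \<longrightarrow> u = u' \<and> v = v')"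

inductive_set SD :: "('a::finite) list set set \<Rightarrow> 'a list set set" for C where
  SD_empty: "{} \<in> SD C"
| SD_letter: "{[a]} \<in> SD C"
| SD_inter: "K \<in> SD C \<Longrightarrow> L \<in> C \<Longrightarrow> K \<inter> L \<in> SD C"
| SD_union: "K \<in> SD C \<Longrightarrow> L \<in> SD C \<Longrightarrow> K \<inter> L = {} \<Longrightarrow> K \<union> L \<in> SD C"
| SD_conc: "K \<in> SD C \<Longrightarrow> L \<in> SD C \<Longrightarrow> unambiguous K L \<Longrightarrow> K @@ L \<in> SD C"
| SD_star: "K \<in> SD C \<Longrightarrow> prefix_code K \<Longrightarrow> bounded_sync_delay K \<Longrightarrow> lstar K \<in> SD C"

end

theory Submission
  imports Defs "HOL-Library.FuncSet"
begin

text \<open>\<open>SD \<subseteq> SF\<close>: if \<open>K\<close> has synchronization delay \<open>d\<close> and \<open>Z\<close> is the set of nonempty words without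
  prefix in \<open>K\<close>, then a word lies outside \<open>K\<^sup>*\<close> iff it lies in \<open>K\<^sup>i Z\<close> for some \<open>i < d\<close> or in
  \<open>A\<^sup>* K\<^sup>d Z\<close>.

  \<open>SF \<subseteq> SD\<close>: for \<open>L\<close> in \<open>SF(C)\<close> there is a finite quotient-closed subset \<open>T\<close> of \<open>C\<close> such that \<open>L\<close> is
  aperiodic relative to \<open>T\<close>: for large suitable \<open>n\<close>, if \<open>v\<close> and \<open>u\<^sup>n\<close> belong to the same members of
  \<open>T\<close>, then \<open>w = u\<^sup>n v u\<^sup>n\<close> satisfies \<open>w\<^sup>n \<equiv> w\<^sup>n\<^sup>+\<^sup>1\<close> for the syntactic congruence of \<open>L\<close>. Let a
  prefix code \<open>P\<close> of bounded delay act on a set \<open>S\<close> of states of the minimal automaton of \<open>L\<close>. If all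
  words of \<open>P\<close> permute \<open>S\<close>, relative aperiodicity makes the action of a word of \<open>P\<^sup>*\<close> depend only on
  the members of \<open>T\<close> containing it, so intersections with languages of \<open>C\<close> suffice. Otherwise let
  \<open>R\<close> be the words of \<open>P\<close> acting as a fixed non-injective map and \<open>P' = P - R\<close>; then
  \<open>P\<^sup>* = (P'\<^sup>* R)\<^sup>* P'\<^sup>*\<close>, where \<open>P'\<close> has fewer actions than \<open>P\<close> and \<open>P'\<^sup>* R\<close> acts on the smaller
  set \<open>S \<cdot> R\<close>.\<close>

section \<open>Languages and prefix codes\<close>

lemma append_eq_append_cases:
  assumes "p @ q = a @ b"
  obtains c where "a = p @ c" "q = c @ b" | c where "p = a @ c" "b = c @ q"
  using assms by (auto simp: append_eq_append_conv2)

section \<open>Concatenation, powers and Kleene star\<close>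

lemma concI: "u \<in> K \<Longrightarrow> v \<in> L \<Longrightarrow> u @ v \<in> K @@ L"
  by (auto simp: conc_def)

lemma concE:
  assumes "w \<in> K @@ L"
  obtains u v where "u \<in> K" "v \<in> L" "w = u @ v"
  using assms by (auto simp: conc_def)

lemma conc_assoc: "(K @@ L) @@ M = K @@ (L @@ M)"
  by (auto simp: conc_def) (metis append_assoc)+

lemma conc_Nil_left [simp]: "{[]} @@ L = L"
  by (auto simp: conc_def)

lemma conc_Nil_right [simp]: "L @@ {[]} = L"
  by (auto simp: conc_def)

lemma lpow_add: "lpow K (m + n) = lpow K m @@ lpow K n"
  by (induction m) (simp_all add: conc_assoc)

lemma lstar_Nil [simp, intro]: "[] \<in> lstar K"
  unfolding lstar_def by (metis UN_iff UNIV_I lpow.simps(1) singletonI)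

lemma lpow_subset_lstar: "lpow K n \<subseteq> lstar K"
  unfolding lstar_def by blast

lemma lstar_append: "x \<in> lstar K \<Longrightarrow> y \<in> lstar K \<Longrightarrow> x @ y \<in> lstar K"
  unfolding lstar_def by (auto simp: lpow_add intro: concI) (metis concI lpow_add)

lemma lstar_single: "k \<in> K \<Longrightarrow> k \<in> lstar K"
proof -
  assume "k \<in> K"
  then have "k \<in> lpow K 1"
    by (auto simp: conc_def)
  then show ?thesis
    using lpow_subset_lstar by blast
qed

lemma lstar_Cons: "k \<in> K \<Longrightarrow> x \<in> lstar K \<Longrightarrow> k @ x \<in> lstar K"
  by (simp add: lstar_append lstar_single)

lemma lstar_induct [consumes 1, case_names Nil Cons]:
  assumes "w \<in> lstar K" "P []"
    and "\<And>k x. k \<in> K \<Longrightarrow> x \<in> lstar K \<Longrightarrow> P x \<Longrightarrow> P (k @ x)"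
  shows "P w"
proof -
  have "\<forall>w\<in>lpow K n. P w" for n
  proof (induction n)
    case (Suc n)
    then show ?case
      using assms(3) lpow_subset_lstar by (fastforce elim: concE)
  qed (simp add: assms(2))
  then show ?thesis
    using assms(1) by (auto simp: lstar_def)
qed

lemma lstar_cases [consumes 1, case_names Nil Cons]:
  assumes "w \<in> lstar K"
  obtains "w = []" | k x where "k \<in> K" "x \<in> lstar K" "w = k @ x"
  using assms by (induction rule: lstar_induct) blast+

lemma lstar_mono: "x \<in> lstar K \<Longrightarrow> K \<subseteq> L \<Longrightarrow> x \<in> lstar L"
  by (induction rule: lstar_induct) (auto intro: lstar_Cons)

lemma lstar_unfold: "lstar K = {[]} \<union> K @@ lstar K"
  by (auto elim: lstar_cases concE intro: lstar_Cons concI)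

lemma lplus_eq_lstar:
  assumes "prefix_code K"
  shows "lplus K = lstar K - {[]}"
proof -
  have "[] \<notin> lpow K n" if "n \<ge> 1" for n
    using that assms by (cases n) (auto simp: conc_def prefix_code_def)
  moreover have "w \<in> lplus K" if "w \<in> lpow K n" "w \<noteq> []" for w n
    using that unfolding lplus_def by (cases n) (auto intro!: bexI[of _ n])
  ultimately show ?thesis
    unfolding lstar_def lplus_def by (auto simp: lplus_def)
qed

section \<open>Prefix codes, unique factorization and synchronization\<close>

lemma prefix_codeD:
  assumes "prefix_code K" "k \<in> K" "k' \<in> K" "k @ x = k' @ y"
  shows "k = k' \<and> x = y"
proof -
  have no: "c = []" if "a @ c \<in> K" "a \<in> K" for a c
    using assms(1) that unfolding prefix_code_def conc_def by blast
  from assms(4) obtain c where "k @ c = k' \<or> k' @ c = k"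
    by (auto simp: append_eq_append_conv2)
  then have "k = k'"
    using no assms(2,3) by fastforce
  then show ?thesis
    using assms(4) by simp
qed

lemma prefix_code_Nil: "prefix_code K \<Longrightarrow> [] \<notin> K"
  by (simp add: prefix_code_def)

lemma prefix_codeI:
  assumes "[] \<notin> K" "\<And>k k' x y. k \<in> K \<Longrightarrow> k' \<in> K \<Longrightarrow> k @ x = k' @ y \<Longrightarrow> k = k'"
  shows "prefix_code K"
  unfolding prefix_code_def
proof (intro conjI equals0I assms(1))
  fix w assume "w \<in> K \<inter> K @@ (UNIV - {[]})"
  then obtain k v where "k \<in> K" "w \<in> K" "v \<noteq> []" "w = k @ v"
    by (auto simp: conc_def)
  then show False
    using assms(2)[of k w v "[]"] by (metis append_Nil2 append_self_conv)
qed

lemma prefix_code_subset: "prefix_code K \<Longrightarrow> K' \<subseteq> K \<Longrightarrow> prefix_code K'"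
  by (rule prefix_codeI) (use prefix_codeD prefix_code_Nil in blast)+

lemma lstar_left_unitary:
  assumes "prefix_code K" "x \<in> lstar K" "x @ y \<in> lstar K"
  shows "y \<in> lstar K"
  using assms(2,3)
proof (induction rule: lstar_induct)
  case (Cons k x)
  have "k \<noteq> []"
    using Cons.hyps assms(1) prefix_code_Nil by blast
  with Cons.prems obtain k' z where "k' \<in> K" "z \<in> lstar K" "k @ x @ y = k' @ z"
    by (auto elim: lstar_cases)
  then show ?case
    using prefix_codeD[OF assms(1) Cons.hyps(1)] Cons.IH by blast
qed simp

text \<open>Factorizations over the prefix code \<open>K\<close> are unique, so the factors of
  \<open>x\<close> are the first factors of the \<open>K'\<close>-factorization of
  \<open>x @ y\<close>. This carries a synchronization delay over to subcodes.\<close>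

lemma lstar_prefix_subset:
  assumes "prefix_code K" "K' \<subseteq> K" "x \<in> lstar K" "x @ y \<in> lstar K'"
  shows "x \<in> lstar K'"
  using assms(3,4)
proof (induction rule: lstar_induct)
  case (Cons k x)
  have "k \<noteq> []"
    using Cons.hyps assms(1) prefix_code_Nil by blast
  with Cons.prems obtain k' z where k': "k' \<in> K'" "z \<in> lstar K'" "k @ x @ y = k' @ z"
    by (auto elim: lstar_cases)
  then have "k = k'" "x @ y = z"
    using prefix_codeD[OF assms(1) Cons.hyps(1)] assms(2) by blast+
  then show ?case
    using Cons.IH k' by (auto intro: lstar_Cons)
qed simp

lemma sync_delay_bounded: "sync_delay K d \<Longrightarrow> bounded_sync_delay K"
  unfolding bounded_sync_delay_def sync_delay_def by blast

lemma sync_delay_subset: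
  assumes "sync_delay K d" "K' \<subseteq> K"
  shows "sync_delay K' d"
  unfolding sync_delay_def
proof (intro conjI allI impI)
  have K: "prefix_code K" "d \<ge> 1"
    using assms(1) by (auto simp: sync_delay_def)
  show K': "prefix_code K'"
    using K assms(2) prefix_code_subset by blast
  show "d \<ge> 1" by (rule K)
  fix u v w assume uvw: "u @ v @ w \<in> lplus K' \<and> v \<in> lpow K' d"
  have pow: "lpow K' n \<subseteq> lpow K n" for n
    using assms(2) by (induction n) (auto simp: conc_def)
  have "u @ v @ w \<in> lplus K"
    using uvw pow by (auto simp: lplus_def)
  then have "u @ v \<in> lplus K"
    using assms(1) uvw pow unfolding sync_delay_def by blast
  then have "u @ v \<in> lstar K" "u @ v \<noteq> []"
    using K by (auto simp: lplus_eq_lstar)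
  moreover have "(u @ v) @ w \<in> lstar K'"
    using uvw K' by (auto simp: lplus_eq_lstar)
  ultimately show "u @ v \<in> lplus K'"
    using lstar_prefix_subset[OF K(1) assms(2)] K' by (auto simp: lplus_eq_lstar)
qed

lemma unambiguous_prefix_code: "prefix_code K \<Longrightarrow> unambiguous K L"
  unfolding unambiguous_def using prefix_codeD by blast

text \<open>Since no word of \<open>Z\<close> has a prefix in \<open>K\<close>, the left factor is
  found by reading off code words for as long as possible. Later \<open>K\<close> is the code of
  return words and \<open>Z\<close> is \<open>lstar P'\<close>.\<close>

lemma unambiguous_lstar:
  assumes "prefix_code K" "\<And>k y. k \<in> K \<Longrightarrow> k @ y \<notin> Z"
  shows "unambiguous (lstar K) Z"
proof -
  have "a = a'" if "a \<in> lstar K" "a' \<in> lstar K" "x \<in> Z" "x' \<in> Z" "a @ x = a' @ x'" for a a' x x'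
    using that
  proof (induction arbitrary: a' rule: lstar_induct)
    case Nil
    from Nil(1) show ?case
    proof (cases rule: lstar_cases)
      case (Cons k y)
      then show ?thesis
        using Nil assms(2)[of k "y @ x'"] by simp
    qed simp
  next
    case (Cons k b)
    from Cons.prems(1) show ?case
    proof (cases rule: lstar_cases)
      case Nil
      then show ?thesis
        using Cons assms(2)[of k "b @ x"] by simp
    next
      case (Cons k' b')
      then have "k = k'" "b @ x = b' @ x'"
        using prefix_codeD[OF assms(1) \<open>k \<in> K\<close> \<open>k' \<in> K\<close>, of "b @ x" "b' @ x'"] Cons.prems by auto
      then show ?thesis
        using Cons Cons.IH Cons.prems by blast
    qed
  qed
  then show ?thesis
    unfolding unambiguous_def by blast
qed

section \<open>Return words to a subset \<open>R\<close> of a prefix code\<close>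

lemma return_words_unique:
  assumes P: "prefix_code P" "P' \<subseteq> P" "R \<subseteq> P" "P' \<inter> R = {}"
    and "x \<in> lstar P'" "x' \<in> lstar P'" "r \<in> R" "r' \<in> R" "x @ r @ y = x' @ r' @ y'"
  shows "x = x' \<and> r = r' \<and> y = y'"
  using assms(5-)
\<comment> \<open>Code words of \<open>P\<close> are read off from the left, each one forced by the
  prefix property; \<open>r\<close> and \<open>r'\<close> are both the first one that lies in
  \<open>R\<close>.\<close>
proof (induction arbitrary: x' rule: lstar_induct)
  case Nil
  from Nil(1) show ?case
  proof (cases rule: lstar_cases)
    case Nil
    then show ?thesis
      using prefix_codeD[OF P(1)] P(3) \<open>r \<in> R\<close> \<open>r' \<in> R\<close> \<open>[] @ r @ y = x' @ r' @ y'\<close>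
      by (metis append_Nil subsetD)
  next
    case (Cons k z)
    then have "r = k"
      using prefix_codeD[OF P(1), of r k y "z @ r' @ y'"] P Nil by auto
    then show ?thesis
      using Cons Nil P(4) by blast
  qed
next
  case (Cons k z)
  from Cons.prems(1) show ?case
  proof (cases rule: lstar_cases)
    case Nil
    then have "k = r'"
      using prefix_codeD[OF P(1), of k r' "z @ r @ y" y'] P Cons by auto
    then show ?thesis
      using Cons P(4) by blast
  next
    case (Cons k' z')
    then have "k = k' \<and> z @ r @ y = z' @ r' @ y'"
      using prefix_codeD[OF P(1), of k k' "z @ r @ y" "z' @ r' @ y'"] P Cons.prems Cons.hyps by auto
    then show ?thesis
      using Cons Cons.IH Cons.prems by blast
  qed
qed

text \<open>Reading code words of \<open>P\<close> from the left passes \<open>x\<close> and then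
  meets \<open>r\<close>, which is outside \<open>P'\<close>. This supplies the hypothesis on
  \<open>Z\<close> in \<open>unambiguous_lstar\<close>.\<close>

lemma return_word_not_prefix:
  assumes P: "prefix_code P" "P' \<subseteq> P" "R \<subseteq> P" "P' \<inter> R = {}"
    and "x \<in> lstar P'" "r \<in> R"
  shows "x @ r @ y \<notin> lstar P'"
  using assms(5)
proof (induction rule: lstar_induct)
  case Nil
  show ?case
  proof
    assume "[] @ r @ y \<in> lstar P'"
    then show False
    proof (cases rule: lstar_cases)
      case Nil
      then show False
        using assms(6) P(1,3) prefix_code_Nil by auto
    next
      case (Cons k z)
      then have "r = k"
        using prefix_codeD[OF P(1), of r k y z] P assms(6) by auto
      then show False
        using Cons assms(6) P(4) by blast
    qed
  qed
next
  case (Cons k z)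
  show ?case
  proof
    assume "(k @ z) @ r @ y \<in> lstar P'"
    then have "k @ (z @ r @ y) \<in> lstar P'" by simp
    then have "z @ r @ y \<in> lstar P'"
      using lstar_left_unitary[OF prefix_code_subset[OF P(1,2)]] Cons.hyps lstar_single by blast
    then show False
      using Cons.IH by blast
  qed
qed

lemma prefix_code_return_words:
  assumes "prefix_code P" "P' \<subseteq> P" "R \<subseteq> P" "P' \<inter> R = {}"
  shows "prefix_code (lstar P' @@ R)"
proof (rule prefix_codeI)
  show "[] \<notin> lstar P' @@ R"
    using assms(1,3) prefix_code_Nil by (auto elim!: concE)
  fix k k' x y assume "k \<in> lstar P' @@ R" "k' \<in> lstar P' @@ R" "k @ x = k' @ y"
  then obtain a r a' r' where "a \<in> lstar P'" "r \<in> R" "k = a @ r"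
    "a' \<in> lstar P'" "r' \<in> R" "k' = a' @ r'" "a @ r @ x = a' @ r' @ y"
    by (auto elim!: concE)
  then show "k = k'"
    using return_words_unique[OF assms, of a a' r r' x y] by simp
qed

lemma unambiguous_return_words:
  assumes "prefix_code P" "P' \<subseteq> P" "R \<subseteq> P" "P' \<inter> R = {}"
  shows "unambiguous (lstar P') R"
  unfolding unambiguous_def using return_words_unique[OF assms, where y = "[]" and y' = "[]"] by auto

text \<open>A word of \<open>lstar P\<close> is cut after each factor from \<open>R\<close>; what
  follows the last cut is the part in \<open>lstar P'\<close>.\<close>

lemma lstar_return_words:
  assumes "P = P' \<union> R"
  shows "lstar P = lstar (lstar P' @@ R) @@ lstar P'"
proof (intro equalityI subsetI)
  let ?Q = "lstar P' @@ R"
  have Q: "z \<in> lstar P" if "z \<in> ?Q" for z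
    using that assms by (auto elim!: concE intro: lstar_append lstar_mono lstar_single)
  have "z \<in> lstar P" if "z \<in> lstar ?Q" for z
    using that by (induction rule: lstar_induct) (auto intro: lstar_append Q)
  then show "w \<in> lstar P" if "w \<in> lstar ?Q @@ lstar P'" for w
    using that assms by (auto elim!: concE intro: lstar_append lstar_mono)
  show "w \<in> lstar ?Q @@ lstar P'" if "w \<in> lstar P" for w
    using that
  proof (induction rule: lstar_induct)
    case Nil
    show ?case
      using concI[OF lstar_Nil lstar_Nil] by simp
  next
    case (Cons k x)
    then obtain q z where qz: "q \<in> lstar ?Q" "z \<in> lstar P'" "x = q @ z"
      by (auto elim: concE)
    show ?case
    proof (cases "k \<in> P'")
      case False
      then have "k \<in> ?Q"
        using Cons assms concI[of "[]" "lstar P'" k R] by auto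
      then show ?thesis
        using qz concI[OF lstar_Cons] by fastforce
    next
      \<comment> \<open>A leading factor from \<open>P'\<close> is absorbed by the first return
        word, or by the remainder if there is no return word.\<close>
      case True
      from qz(1) show ?thesis
      proof (cases rule: lstar_cases)
        case Nil
        then show ?thesis
          using qz True concI[of "[]" "lstar ?Q" "k @ z"] by (auto intro: lstar_Cons)
      next
        case (Cons c q')
        then obtain a r where ar: "a \<in> lstar P'" "r \<in> R" "c = a @ r"
          by (auto elim: concE)
        have "(k @ a) @ r \<in> ?Q"
          using ar True by (intro concI lstar_Cons)
        then have "((k @ a) @ r) @ q' \<in> lstar ?Q"
          using Cons by (intro lstar_Cons)
        from concI[OF this qz(2)] show ?thesis
          using Cons ar qz by simp
      qed
    qed
  qed
qed

text \<open>Of the \<open>Suc d\<close> return words in \<open>v\<close>, the first \<open>d\<close>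
  contain at least \<open>d\<close> words of \<open>P\<close> and so synchronize \<open>P\<close> at
  their end. The last one ends with a word of \<open>R\<close>, which closes the pending return
  word.\<close>

lemma sync_delay_return_words:
  assumes "sync_delay P d" "P = P' \<union> R" "P' \<inter> R = {}"
  shows "sync_delay (lstar P' @@ R) (Suc d)"
  unfolding sync_delay_def
proof (intro conjI allI impI)
  let ?Q = "lstar P' @@ R"
  have P: "prefix_code P" "d \<ge> 1"
    using assms(1) by (auto simp: sync_delay_def)
  show Q: "prefix_code ?Q"
    using prefix_code_return_words[OF P(1)] assms by blast
  show "Suc d \<ge> 1" by simp
  fix u v w assume uvw: "u @ v @ w \<in> lplus ?Q \<and> v \<in> lpow ?Q (Suc d)"
  \<comment> \<open>Each return word consists of at least one word of \<open>P\<close>, so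
    \<open>n\<close> of them give at least \<open>n\<close>.\<close>
  have "\<exists>m\<ge>n. z \<in> lpow P m" if "z \<in> lpow ?Q n" for z n
    using that
  proof (induction n arbitrary: z)
    case (Suc n)
    then obtain a r y where ary: "a \<in> lstar P'" "r \<in> R" "y \<in> lpow ?Q n" "z = (a @ r) @ y"
      by (auto elim!: concE)
    then obtain m where m: "m \<ge> n" "y \<in> lpow P m"
      using Suc.IH by blast
    have "a \<in> lstar P"
      using ary assms lstar_mono by blast
    then obtain l where "a \<in> lpow P l"
      by (auto simp: lstar_def)
    then have "a @ (r @ y) \<in> lpow P (l + Suc m)"
      unfolding lpow_add using ary m assms by (auto intro!: concI)
    then show ?case
      using ary m by (intro exI[of _ "l + Suc m"]) auto
  next
    case 0
    then show ?case
      using lpow.simps(1) by blast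
  qed
  moreover have "v \<in> lpow ?Q d @@ ?Q"
    using uvw lpow_add[of ?Q d 1] by simp
  then obtain y q where yq: "y \<in> lpow ?Q d" "q \<in> ?Q" "v = y @ q"
    by (rule concE)
  ultimately obtain m where m: "m \<ge> d" "y \<in> lpow P m"
    by blast
  \<comment> \<open>Only the last \<open>d\<close> code words of \<open>y\<close> serve as the
    synchronizing block; the earlier ones join the left context \<open>u\<close>.\<close>
  then have "y \<in> lpow P ((m - d) + d)"
    by simp
  then obtain y1 y2 where y: "y2 \<in> lpow P d" "y = y1 @ y2"
    unfolding lpow_add by (auto elim: concE)
  have star: "lstar P = lstar ?Q @@ lstar P'"
    using lstar_return_words assms(2) by blast
  have "u @ v @ w \<in> lstar ?Q @@ lstar P'" "u @ v @ w \<noteq> []"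
    using uvw Q concI[of "u @ v @ w" "lstar ?Q" "[]" "lstar P'"]
    by (auto simp: lplus_eq_lstar)
  then have "(u @ y1) @ y2 @ (q @ w) \<in> lplus P"
    using P star y yq by (auto simp: lplus_eq_lstar)
  then have "(u @ y1) @ y2 \<in> lplus P"
    using assms(1) y unfolding sync_delay_def by blast
  then have "u @ y \<in> lstar ?Q @@ lstar P'"
    using P star y by (auto simp: lplus_eq_lstar)
  then obtain s t where st: "s \<in> lstar ?Q" "t \<in> lstar P'" "u @ y = s @ t"
    by (auto elim: concE)
  obtain a r where ar: "a \<in> lstar P'" "r \<in> R" "q = a @ r"
    using yq by (auto elim: concE)
  \<comment> \<open>The rest \<open>t\<close> after the last return word of \<open>u @ y\<close>
    merges with \<open>q = a @ r\<close> into a single return word.\<close>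
  have "(t @ a) @ r \<in> ?Q"
    using st ar by (intro concI lstar_append)
  then have "s @ ((t @ a) @ r) \<in> lstar ?Q"
    using st lstar_append lstar_single by blast
  then have "u @ v \<in> lstar ?Q"
    using st ar yq by (metis append_assoc)
  moreover have "r \<noteq> []"
    using ar P(1) assms(2) prefix_code_Nil by blast
  ultimately show "u @ v \<in> lplus ?Q"
    using Q yq ar by (auto simp: lplus_eq_lstar)
qed


section \<open>From bounded synchronization delay to star-free expressions\<close>

lemma lpow_left_unitary:
  assumes "prefix_code K" "x \<in> lpow K n" "x @ y \<in> lstar K"
  shows "y \<in> lstar K"
  using assms lstar_left_unitary lpow_subset_lstar by blast

text \<open>Words of \<open>K\<close> are stripped from the left until no prefix in \<open>K\<close>
  remains; each strip shortens the word.\<close>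

lemma lpow_maximal_prefix: "\<exists>n. w \<in> lpow K n @@ (- (K @@ UNIV))" if "[] \<notin> K"
proof (induction w rule: length_induct)
  case (1 w)
  show ?case
  proof (cases "w \<in> K @@ UNIV")
    case False
    then have "[] @ w \<in> lpow K 0 @@ (- (K @@ UNIV))"
      by (intro concI) auto
    then show ?thesis
      by (intro exI[of _ 0]) simp
  next
    case True
    then obtain k v where kv: "k \<in> K" "w = k @ v"
      by (auto elim: concE)
    then have "length v < length w"
      using that by auto
    then obtain n where "v \<in> lpow K n @@ (- (K @@ UNIV))"
      using 1 by blast
    then have "w \<in> lpow K (Suc n) @@ (- (K @@ UNIV))"
      using kv by (auto simp: conc_assoc intro: concI)
    then show ?thesis by blast
  qed
qed

text \<open>Outside \<open>lstar K\<close>, stripping code words from the left stops at a word of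
  \<open>Z\<close>; if at least \<open>d\<close> were stripped, all but the last \<open>d\<close>
  are hidden in \<open>UNIV\<close>. The delay ensures that this catches no word of
  \<open>lstar K\<close>: otherwise \<open>u @ v\<close> would lie in \<open>lstar K\<close>, and
  hence so would \<open>z\<close>.\<close>

lemma compl_lstar_sync_delay:
  assumes "sync_delay K d"
  defines "Z \<equiv> - (K @@ UNIV) - {[]}"
  shows "- lstar K = (\<Union>i<d. lpow K i @@ Z) \<union> UNIV @@ lpow K d @@ Z"
proof -
  have K: "prefix_code K"
    using assms(1) by (auto simp: sync_delay_def)
  have Z: "z \<notin> lstar K" if "z \<in> Z" for z
    using that unfolding Z_def by (metis ComplD DiffD1 DiffD2 UNIV_I concI lstar_cases singletonI)
  show ?thesis
  proof (intro equalityI subsetI)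
    fix w assume w: "w \<in> - lstar K"
    obtain n x z where nxz: "x \<in> lpow K n" "z \<in> - (K @@ UNIV)" "w = x @ z"
      using lpow_maximal_prefix[OF prefix_code_Nil[OF K], of w] by (auto elim: concE)
    then have "z \<noteq> []"
      using w lpow_subset_lstar[of K n] by auto
    then have zZ: "z \<in> Z"
      using nxz by (auto simp: Z_def)
    show "w \<in> (\<Union>i<d. lpow K i @@ Z) \<union> UNIV @@ lpow K d @@ Z"
    proof (cases "n < d")
      case True
      then show ?thesis
        using nxz zZ by (auto intro: concI)
    next
      case False
      then have "x \<in> lpow K (n - d) @@ lpow K d"
        using nxz lpow_add[of K "n - d" d] by simp
      then obtain a b where "b \<in> lpow K d" "x = a @ b"
        by (auto elim: concE)
      then show ?thesis
        using nxz zZ by (auto intro: concI)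
    qed
  next
    fix w assume "w \<in> (\<Union>i<d. lpow K i @@ Z) \<union> UNIV @@ lpow K d @@ Z"
    then consider i x z where "x \<in> lpow K i" "z \<in> Z" "w = x @ z"
      | u v z where "v \<in> lpow K d" "z \<in> Z" "w = u @ v @ z"
      by (auto elim!: concE)
    then show "w \<in> - lstar K"
    proof cases
      case 1
      then show ?thesis
        using Z lpow_left_unitary[OF K] by blast
    next
      case 2
      show ?thesis
      proof
        assume "w \<in> lstar K"
        moreover have "w \<noteq> []"
          using 2 by (auto simp: Z_def)
        ultimately have "u @ v @ z \<in> lplus K"
          using 2 K by (auto simp: lplus_eq_lstar)
        then have "u @ v \<in> lplus K"
          using assms(1) 2 unfolding sync_delay_def by blast
        then have "u @ v \<in> lstar K" "(u @ v) @ z \<in> lstar K"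
          using K 2 \<open>w \<in> lstar K\<close> by (auto simp: lplus_eq_lstar)
        then show False
          using lstar_left_unitary[OF K] Z 2 by blast
      qed
    qed
  qed
qed

section \<open>Closure properties of \<open>SF\<close> and the first inclusion\<close>

lemma SF_inter: "K \<in> SF C \<Longrightarrow> L \<in> SF C \<Longrightarrow> K \<inter> L \<in> SF C"
  using SF_compl[OF SF_union[OF SF_compl SF_compl], of K C L] by simp

lemma SF_UN:
  assumes "{} \<in> SF C" "finite I" "\<And>i. i \<in> I \<Longrightarrow> F i \<in> SF C"
  shows "(\<Union>i\<in>I. F i) \<in> SF C"
  using assms(2,3) by (induction rule: finite_induct) (auto intro: SF_union assms(1))

lemma SF_eps:
  assumes "UNIV \<in> SF C"
  shows "{[]} \<in> SF (C :: 'a::finite list set set)"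
proof -
  have "{} \<in> SF C"
    using SF_compl[OF assms] by simp
  then have "(\<Union>a. {[a]} @@ UNIV) \<in> SF C"
    by (intro SF_UN SF_conc SF_letter assms) auto
  moreover have "- (\<Union>a::'a. {[a]} @@ UNIV) = {[]}"
  proof (intro equalityI subsetI)
    fix w :: "'a list" assume "w \<in> - (\<Union>a. {[a]} @@ UNIV)"
    then show "w \<in> {[]}"
      by (cases w) (auto simp: conc_def)
  qed (auto simp: conc_def)
  ultimately show ?thesis
    using SF_compl by metis
qed

lemma SF_lstar:
  assumes "UNIV \<in> SF C" "K \<in> SF C" "sync_delay K d"
  shows "lstar K \<in> SF C"
proof -
  have pow: "lpow K n \<in> SF C" for n
    by (induction n) (auto intro: SF_conc SF_eps assms)
  have "{} \<in> SF C"
    using SF_compl[OF assms(1)] by simp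
  moreover have "- (K @@ UNIV) - {[]} \<in> SF C"
    unfolding Diff_eq by (intro SF_inter SF_compl SF_conc SF_eps assms)
  ultimately have "- lstar K \<in> SF C"
    unfolding compl_lstar_sync_delay[OF assms(3)]
    by (intro SF_union SF_UN SF_conc pow assms) auto
  then show ?thesis
    using SF_compl by fastforce
qed

lemma SD_subset_SF:
  assumes "prevariety C" "L \<in> SD C"
  shows "L \<in> SF C"
proof -
  have C: "{} \<in> SF C" "UNIV \<in> SF C"
    using assms(1) by (auto simp: prevariety_def intro: SF_base)
  from assms(2) show ?thesis
  proof induction
    case (SD_star K)
    then show ?case
      using SF_lstar[OF C(2)] by (auto simp: bounded_sync_delay_def)
  qed (auto intro: SF.intros SF_inter C)
qed

section \<open>Left quotients\<close>

lemma lquot_append: "lquot (u @ v) L = lquot v (lquot u L)"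
  by (simp add: lquot_def)

lemma lquot_Nil [simp]: "lquot [] L = L"
  by (simp add: lquot_def)

lemma finite_lquot_Un:
  assumes "finite (range (\<lambda>u. lquot u K))" "finite (range (\<lambda>u. lquot u L))"
  shows "finite (range (\<lambda>u. lquot u (K \<union> L)))"
proof -
  have "lquot u (K \<union> L) = lquot u K \<union> lquot u L" for u
    by (auto simp: lquot_def)
  then have "range (\<lambda>u. lquot u (K \<union> L))
      \<subseteq> (\<lambda>(X, Y). X \<union> Y) ` (range (\<lambda>u. lquot u K) \<times> range (\<lambda>u. lquot u L))"
    by auto
  then show ?thesis
    by (rule finite_subset) (use assms in auto)
qed

lemma finite_lquot_compl:
  assumes "finite (range (\<lambda>u. lquot u K))"
  shows "finite (range (\<lambda>u. lquot u (- K)))"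
proof -
  have "lquot u (- K) = - lquot u K" for u
    by (auto simp: lquot_def)
  then have "range (\<lambda>u. lquot u (- K)) = uminus ` range (\<lambda>u. lquot u K)"
    by (simp add: image_image)
  then show ?thesis
    using assms by simp
qed

lemma lquot_conc: "lquot u (K @@ L) = lquot u K @@ L \<union> \<Union>{lquot y L |x y. u = x @ y \<and> x \<in> K}"
  (is "?l = ?r")
proof (intro equalityI subsetI)
  fix w assume "w \<in> ?l"
  then obtain a b where ab: "a \<in> K" "b \<in> L" "u @ w = a @ b"
    by (auto simp: lquot_def elim: concE)
  then consider c where "a = u @ c" "w = c @ b" | c where "u = a @ c" "b = c @ w"
    by (auto simp: append_eq_append_conv2)
  then show "w \<in> ?r"
  proof cases
    case 1
    then show ?thesis
      using ab by (auto simp: lquot_def intro: concI)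
  next
    case 2
    then have "w \<in> lquot c L"
      using ab by (simp add: lquot_def)
    then show ?thesis
      using 2 ab by blast
  qed
next
  fix w assume "w \<in> ?r"
  then consider a b where "u @ a \<in> K" "b \<in> L" "w = a @ b"
    | x y where "u = x @ y" "x \<in> K" "y @ w \<in> L"
    by (auto simp: lquot_def conc_def)
  then show "w \<in> ?l"
    by cases (auto simp: lquot_def conc_def, (metis append_assoc)+)
qed

text \<open>By \<open>lquot_conc\<close>, a quotient of \<open>K @@ L\<close> is determined by one
  quotient of \<open>K\<close> and a set of quotients of \<open>L\<close>.\<close>

lemma finite_lquot_conc:
  assumes "finite (range (\<lambda>u. lquot u K))" "finite (range (\<lambda>u. lquot u L))"
  shows "finite (range (\<lambda>u. lquot u (K @@ L)))"
proof -
  have "range (\<lambda>u. lquot u (K @@ L))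
      \<subseteq> (\<lambda>(X, Y). X @@ L \<union> \<Union>Y) ` (range (\<lambda>u. lquot u K) \<times> Pow (range (\<lambda>u. lquot u L)))"
  proof
    fix X assume "X \<in> range (\<lambda>u. lquot u (K @@ L))"
    then obtain u where "X = lquot u (K @@ L)" by blast
    then show "X \<in> (\<lambda>(X, Y). X @@ L \<union> \<Union>Y) ` (range (\<lambda>u. lquot u K) \<times> Pow (range (\<lambda>u. lquot u L)))"
      unfolding lquot_conc
      by (intro image_eqI[of _ _ "(lquot u K, {lquot y L |x y. u = x @ y \<and> x \<in> K})"])
        (simp, blast)
  qed
  then show ?thesis
    by (rule finite_subset) (use assms in auto)
qed

lemma lstar_cut:
  assumes "u @ w \<in> lstar K"
  shows "u \<in> lstar K \<and> w \<in> lstar K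
    \<or> (\<exists>x y a b. u = x @ y \<and> x \<in> lstar K \<and> y @ a \<in> K \<and> b \<in> lstar K \<and> w = a @ b)"
  using assms
proof (induction "u @ w" arbitrary: u rule: lstar_induct)
  case (Cons k z)
  from \<open>k @ z = u @ w\<close> consider c where "u = k @ c" "z = c @ w" | c where "k = u @ c" "w = c @ z"
    by (auto simp: append_eq_append_conv2)
  then show ?case
  proof cases
    case 1
    from Cons.hyps(3)[OF 1(2)] show ?thesis
    proof (elim disjE exE conjE)
      fix x y a b assume "c = x @ y" "x \<in> lstar K" "y @ a \<in> K" "b \<in> lstar K" "w = a @ b"
      then show ?thesis
        using 1 Cons.hyps(1) by (intro disjI2 exI[of _ "k @ x"] exI[of _ y] exI[of _ a] exI[of _ b])
          (auto intro: lstar_Cons)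
    qed (use 1 Cons.hyps(1) in \<open>auto intro: lstar_Cons\<close>)
  next
    case 2
    then show ?thesis
      using Cons.hyps by (intro disjI2 exI[of _ "[]"] exI[of _ u] exI[of _ c] exI[of _ z]) auto
  qed
qed simp

text \<open>By \<open>lstar_cut\<close>, the end of \<open>u\<close> falls between two factors or
  within one. The first case is listed separately because \<open>y = []\<close> in the second gives
  only \<open>K @@ lstar K\<close>, which may miss the empty word.\<close>

lemma lquot_lstar:
  "lquot u (lstar K) = (if u \<in> lstar K then lstar K else {})
    \<union> \<Union>{lquot y K @@ lstar K |x y. u = x @ y \<and> x \<in> lstar K}" (is "?l = ?r")
proof (intro equalityI subsetI)
  fix w assume "w \<in> ?l"
  then have "u @ w \<in> lstar K"
    by (simp add: lquot_def)
  from lstar_cut[OF this] show "w \<in> ?r"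
    by (auto simp: lquot_def conc_def)
next
  fix w assume "w \<in> ?r"
  then consider "u \<in> lstar K" "w \<in> lstar K"
    | x y a b where "u = x @ y" "x \<in> lstar K" "y @ a \<in> K" "b \<in> lstar K" "w = a @ b"
    by (auto simp: lquot_def conc_def split: if_splits)
  then show "w \<in> ?l"
  proof cases
    case 2
    then have "x @ (y @ a) @ b \<in> lstar K"
      by (intro lstar_append lstar_Cons)
    then show ?thesis
      using 2 by (simp add: lquot_def)
  qed (simp add: lquot_def lstar_append)
qed

lemma finite_lquot_lstar:
  assumes "finite (range (\<lambda>u. lquot u K))"
  shows "finite (range (\<lambda>u. lquot u (lstar K)))"
proof -
  have "range (\<lambda>u. lquot u (lstar K)) \<subseteq>
    (\<lambda>(X, Y). X \<union> \<Union>Y) ` ({lstar K, {}} \<times> Pow ((\<lambda>X. X @@ lstar K) ` range (\<lambda>u. lquot u K)))"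
    (is "_ \<subseteq> ?A")
  proof
    fix X assume "X \<in> range (\<lambda>u. lquot u (lstar K))"
    then obtain u where "X = lquot u (lstar K)" by blast
    then show "X \<in> ?A"
      unfolding lquot_lstar
      by (intro image_eqI[of _ _ "(if u \<in> lstar K then lstar K else {},
            {lquot y K @@ lstar K |x y. u = x @ y \<and> x \<in> lstar K})"])
        (simp, auto simp del: Union_iff)
  qed
  then show ?thesis
    by (rule finite_subset) (use assms in auto)
qed

lemma finite_lquot_finite:
  assumes "finite L"
  shows "finite (range (\<lambda>u. lquot u L))"
proof -
  have "lquot u L \<subseteq> (\<Union>w\<in>L. (\<lambda>n. drop n w) ` {..length w})" for u
  proof
    fix w assume "w \<in> lquot u L"
    then have "u @ w \<in> L" "w = drop (length u) (u @ w)" "length u \<le> length (u @ w)"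
      by (auto simp: lquot_def)
    then show "w \<in> (\<Union>w\<in>L. (\<lambda>n. drop n w) ` {..length w})"
      by blast
  qed
  then have "range (\<lambda>u. lquot u L) \<subseteq> Pow (\<Union>w\<in>L. (\<lambda>n. drop n w) ` {..length w})"
    by blast
  then show ?thesis
    by (rule finite_subset) (use assms in auto)
qed

lemma finite_lquot_regular: "regular L \<Longrightarrow> finite (range (\<lambda>u. lquot u L))"
  by (induction rule: regular.induct)
    (auto intro: finite_lquot_finite finite_lquot_Un finite_lquot_conc finite_lquot_lstar)

lemma finite_lquot_SF:
  assumes "prevariety C" "L \<in> SF C"
  shows "finite (range (\<lambda>u. lquot u L))"
  using assms(2)
proof induction
  case (SF_base L)
  then show ?case
    using assms(1) finite_lquot_regular by (auto simp: prevariety_def)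
qed (auto intro: finite_lquot_finite finite_lquot_Un finite_lquot_conc finite_lquot_compl)


section \<open>Word powers and profiles\<close>

primrec wpow :: "'a list \<Rightarrow> nat \<Rightarrow> 'a list" where
  "wpow u 0 = []"
| "wpow u (Suc n) = u @ wpow u n"

lemma wpow_add: "wpow u (m + n) = wpow u m @ wpow u n"
  by (induction m) auto

lemma wpow_mult: "wpow u (k * n) = wpow (wpow u n) k"
  by (induction k) (auto simp: wpow_add)

lemma lquot_wpow_id: "lquot v q = q \<Longrightarrow> lquot (wpow v k) q = q"
  by (induction k) (auto simp: lquot_append)

text \<open>Equality of profiles stands in for equality of images under a morphism to a finite
  monoid: for finite quotient-closed \<open>T\<close> it is a congruence of finite index.\<close>

definition profile :: "'a list set set \<Rightarrow> 'a list \<Rightarrow> 'a list set set" where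
  "profile T u = {X \<in> T. u \<in> X}"

definition quot_closed :: "'a list set set \<Rightarrow> bool" where
  "quot_closed T \<longleftrightarrow> (\<forall>X\<in>T. \<forall>u. lquot u X \<in> T \<and> rquot X u \<in> T)"

lemma profile_eq_iff: "profile T u = profile T v \<longleftrightarrow> (\<forall>X\<in>T. u \<in> X \<longleftrightarrow> v \<in> X)"
  unfolding profile_def by blast

lemma profile_mono: "profile T' u = profile T' v \<Longrightarrow> T \<subseteq> T' \<Longrightarrow> profile T u = profile T v"
  unfolding profile_eq_iff by blast

text \<open>The factors are exchanged one at a time; the other factor is moved into a quotient of
  \<open>X\<close>, which is again in \<open>T\<close>.\<close>

lemma profile_append:
  assumes "quot_closed T" "profile T u = profile T u'" "profile T v = profile T v'"
  shows "profile T (u @ v) = profile T (u' @ v')"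
  unfolding profile_eq_iff
proof
  fix X assume X: "X \<in> T"
  then have q: "rquot X v \<in> T" "lquot u' X \<in> T"
    using assms(1) by (auto simp: quot_closed_def)
  have "u @ v \<in> X \<longleftrightarrow> u \<in> rquot X v"
    by (simp add: rquot_def)
  also have "\<dots> \<longleftrightarrow> u' \<in> rquot X v"
    using assms(2) q unfolding profile_eq_iff by blast
  also have "\<dots> \<longleftrightarrow> v \<in> lquot u' X"
    by (simp add: rquot_def lquot_def)
  also have "\<dots> \<longleftrightarrow> v' \<in> lquot u' X"
    using assms(3) q unfolding profile_eq_iff by blast
  finally show "u @ v \<in> X \<longleftrightarrow> u' @ v' \<in> X"
    by (simp add: lquot_def)
qed

text \<open>\<open>W\<close> is a union of finitely many profile classes, and each class is a finite
  Boolean combination of members of \<open>T\<close>.\<close>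

lemma profile_saturated:
  assumes C: "prevariety C" and T: "finite T" "T \<subseteq> C"
    and W: "\<And>u v. profile T u = profile T v \<Longrightarrow> u \<in> W \<Longrightarrow> v \<in> W"
  shows "W \<in> C"
proof -
  have UN: "(\<Union>i\<in>I. F i) \<in> C" if "finite I" "\<And>i. i \<in> I \<Longrightarrow> F i \<in> C" for I :: "'a list set set set" and F
    using that C by (induction rule: finite_induct) (auto simp: prevariety_def)
  have cls: "{v. \<forall>X\<in>T'. v \<in> X \<longleftrightarrow> X \<in> Z} \<in> C" if "finite T'" "T' \<subseteq> C" for T' Z
    using that
  proof (induction rule: finite_induct)
    case (insert Y T')
    have "{v. \<forall>X\<in>insert Y T'. v \<in> X \<longleftrightarrow> X \<in> Z}
      = (if Y \<in> Z then Y else - Y) \<inter> {v. \<forall>X\<in>T'. v \<in> X \<longleftrightarrow> X \<in> Z}"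
      by auto
    then show ?case
      using insert C by (auto simp: prevariety_def)
  qed (use C in \<open>simp add: prevariety_def\<close>)
  have "profile T ` W \<subseteq> Pow T"
    by (auto simp: profile_def)
  then have "finite (profile T ` W)"
    using T finite_subset by blast
  then have "(\<Union>Z\<in>profile T ` W. {v. \<forall>X\<in>T. v \<in> X \<longleftrightarrow> X \<in> Z}) \<in> C"
    by (intro UN cls T)
  moreover have "(\<Union>Z\<in>profile T ` W. {v. \<forall>X\<in>T. v \<in> X \<longleftrightarrow> X \<in> Z}) = W"
  proof (intro equalityI subsetI)
    fix w assume "w \<in> (\<Union>Z\<in>profile T ` W. {v. \<forall>X\<in>T. v \<in> X \<longleftrightarrow> X \<in> Z})"
    then obtain u where "u \<in> W" "\<forall>X\<in>T. w \<in> X \<longleftrightarrow> X \<in> profile T u"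
      by blast
    then show "w \<in> W"
      using W[of u w] by (auto simp: profile_def)
  qed (auto simp: profile_def)
  ultimately show ?thesis
    by simp
qed

definition power_idem :: "'a list set set \<Rightarrow> nat \<Rightarrow> bool" where
  "power_idem T n \<longleftrightarrow> n > 0 \<and> (\<forall>u. profile T (wpow u (n + n)) = profile T (wpow u n))"

lemma power_idem_mult:
  assumes "quot_closed T" "power_idem T n" "k > 0"
  shows "profile T (wpow u (k * n)) = profile T (wpow u n)"
  using assms(3)
proof (induction k)
  case (Suc k)
  show ?case
  proof (cases "k = 0")
    case False
    then have "profile T (wpow u n @ wpow u (k * n)) = profile T (wpow u n @ wpow u n)"
      using Suc.IH by (intro profile_append[OF assms(1)]) auto
    then show ?thesis
      using assms(2) by (simp add: wpow_add power_idem_def)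
  qed simp
qed simp

text \<open>The powers of \<open>u\<close> have at most \<open>N = card (Pow T)\<close> profiles, so
  by pigeonhole they become periodic with index and period at most \<open>N\<close>. The exponent
  \<open>fact N\<close> is beyond the index and a multiple of the period for all \<open>u\<close> at
  once.\<close>

lemma ex_power_idem:
  assumes "finite T" "quot_closed T"
  shows "\<exists>n. power_idem T n"
proof -
  define N where "N = card (Pow T)"
  have "profile T (wpow u (fact N + fact N)) = profile T (wpow u (fact N))" for u
  proof -
    have "(\<lambda>i. profile T (wpow u i)) ` {..N} \<subseteq> Pow T"
      by (auto simp: profile_def)
    then have "card ((\<lambda>i. profile T (wpow u i)) ` {..N}) \<le> N"
      unfolding N_def using assms(1) by (intro card_mono) auto
    then have "\<not> inj_on (\<lambda>i. profile T (wpow u i)) {..N}"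
      using card_image by fastforce
    then obtain i j where ij: "i < j" "j \<le> N" "profile T (wpow u i) = profile T (wpow u j)"
      unfolding inj_on_def by (metis atMost_iff linorder_neqE_nat)
    have step: "profile T (wpow u (m + (j - i))) = profile T (wpow u m)" if "m \<ge> i" for m
    proof -
      have "profile T (wpow u j @ wpow u (m - i)) = profile T (wpow u i @ wpow u (m - i))"
        using ij by (intro profile_append[OF assms(2)]) auto
      then show ?thesis
        using ij that by (simp add: add.commute flip: wpow_add)
    qed
    have steps: "profile T (wpow u (m + k * (j - i))) = profile T (wpow u m)" if "m \<ge> i" for m k
    proof (induction k)
      case (Suc k)
      then show ?case
        using step[of "m + k * (j - i)"] that by (simp add: add.commute add.left_commute)
    qed simp
    have "(j - i) dvd fact N"
      using ij by (intro dvd_fact) auto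
    then obtain k where "fact N = k * (j - i)"
      by (metis dvd_div_mult_self)
    moreover have "fact N \<ge> i"
      using ij fact_ge_self[of N] by linarith
    ultimately show ?thesis
      using steps by metis
  qed
  then show ?thesis
    unfolding power_idem_def by (intro exI[of _ "fact N"]) simp
qed

text \<open>All two-sided quotients of \<open>L\<close> are taken. Regularity bounds the number of
  left quotients, and \<open>rquot M y\<close> depends only on which left quotients of
  \<open>L\<close> contain \<open>y\<close>.\<close>

lemma ex_quot_closed:
  assumes "prevariety C" "L \<in> C"
  obtains T where "finite T" "T \<subseteq> C" "quot_closed T" "L \<in> T"
proof
  let ?T = "\<Union>M\<in>range (\<lambda>x. lquot x L). range (\<lambda>y. rquot M y)"
  have fin: "finite (range (\<lambda>x. lquot x L))"
    using assms finite_lquot_regular by (auto simp: prevariety_def)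
  have "finite (range (\<lambda>y. rquot M y))" if M: "M \<in> range (\<lambda>x. lquot x L)" for M
  proof -
    have "lquot v M \<in> range (\<lambda>x. lquot x L)" for v
      using M by (auto simp flip: lquot_append)
    then have "rquot M y = {v. lquot v M \<in> {N \<in> range (\<lambda>x. lquot x L). y \<in> N}}" for y
      by (auto simp: rquot_def) (auto simp: lquot_def)
    then have "range (\<lambda>y. rquot M y) \<subseteq> (\<lambda>Y. {v. lquot v M \<in> Y}) ` Pow (range (\<lambda>x. lquot x L))"
      by blast
    then show ?thesis
      by (rule finite_subset) (use fin in auto)
  qed
  then show "finite ?T"
    using fin by blast
  show "?T \<subseteq> C"
    using assms by (auto simp: prevariety_def)
  have "lquot u (rquot (lquot x L) y) = rquot (lquot (x @ u) L) y"
    "rquot (rquot (lquot x L) y) u = rquot (lquot x L) (u @ y)" for u x y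
    by (simp_all add: lquot_def rquot_def)
  then show "quot_closed ?T"
    unfolding quot_closed_def by auto
  have "L = rquot (lquot [] L) []"
    by (simp add: rquot_def)
  then show "L \<in> ?T"
    by blast
qed

section \<open>Relative aperiodicity of star-free languages\<close>

definition pumps :: "'a list \<Rightarrow> nat \<Rightarrow> 'a list set \<Rightarrow> bool" where
  "pumps w n L \<longleftrightarrow> (\<forall>x y j. j \<ge> n \<longrightarrow> (x @ wpow w j @ y \<in> L \<longleftrightarrow> x @ wpow w (Suc j) @ y \<in> L))"

text \<open>Modelled on aperiodicity of the products \<open>e t e\<close> in the syntactic monoid,
  where \<open>e\<close> is idempotent and \<open>T\<close> does not separate \<open>t\<close> from
  \<open>e\<close>. Putting \<open>wpow u n\<close> in place of \<open>e\<close> keeps the condition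
  at the level of words, where it can be combined along the operations of \<open>SF\<close>.\<close>

definition rel_aperiodic :: "'a list set set \<Rightarrow> nat \<Rightarrow> 'a list set \<Rightarrow> bool" where
  "rel_aperiodic T n L \<longleftrightarrow>
    (\<forall>u v. profile T v = profile T (wpow u n) \<longrightarrow> pumps (wpow u n @ v @ wpow u n) n L)"

lemma pumps_mono: "pumps w n L \<Longrightarrow> n \<le> n' \<Longrightarrow> pumps w n' L"
  unfolding pumps_def by auto

text \<open>However the word is cut, one of the two factors receives enough whole copies of
  \<open>w\<close> to be pumped on its own. Removing a copy needs \<open>n + 1\<close> of them on
  one side, whence the bound \<open>2 * n + 1\<close>.\<close>

lemma pumps_conc:
  assumes "pumps w n K" "pumps w n L"
  shows "pumps w (2 * n + 1) (K @@ L)"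
  unfolding pumps_def
proof (intro allI impI iffI)
  fix x y j assume j: "2 * n + 1 \<le> (j::nat)"
  have K: "x @ wpow w (Suc i) @ c \<in> K \<longleftrightarrow> x @ wpow w i @ c \<in> K" if "i \<ge> n" for i x c
    using assms(1) that by (auto simp: pumps_def)
  have L: "c @ wpow w (Suc i) @ y \<in> L \<longleftrightarrow> c @ wpow w i @ y \<in> L" if "i \<ge> n" for i c
    using assms(2) that by (auto simp: pumps_def)
  {
    assume "x @ wpow w j @ y \<in> K @@ L"
    then obtain a b where ab: "a \<in> K" "b \<in> L" "x @ wpow w j @ y = a @ b"
      by (rule concE)
    have "wpow w j = wpow w n @ wpow w (j - n)"
      using j by (simp flip: wpow_add)
    then have "(x @ wpow w n) @ (wpow w (j - n) @ y) = a @ b"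
      using ab by simp
    then consider c where "a = x @ wpow w n @ c" "wpow w (j - n) @ y = c @ b"
      | c where "x @ wpow w n = a @ c" "b = c @ wpow w (j - n) @ y"
      by (elim append_eq_append_cases) auto
    then show "x @ wpow w (Suc j) @ y \<in> K @@ L"
    proof cases
      case 1
      then have "(x @ wpow w (Suc n) @ c) @ b \<in> K @@ L"
        using ab K by (intro concI) auto
      moreover have "wpow w (Suc j) = wpow w (Suc n) @ wpow w (j - n)"
        using j by (simp flip: wpow_add wpow.simps)
      ultimately show ?thesis
        using 1 by simp
    next
      case 2
      then have "a @ (c @ wpow w (Suc (j - n)) @ y) \<in> K @@ L"
        using ab L[of "j - n" c] j by (intro concI) auto
      moreover have "wpow w (Suc j) = wpow w n @ wpow w (Suc (j - n))"
        using j by (simp flip: wpow_add wpow.simps)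
      ultimately show ?thesis
        using 2 by (metis append_assoc)
    qed
  next
    assume "x @ wpow w (Suc j) @ y \<in> K @@ L"
    then obtain a b where ab: "a \<in> K" "b \<in> L" "x @ wpow w (Suc j) @ y = a @ b"
      by (rule concE)
    have "wpow w (Suc j) = wpow w (Suc n) @ wpow w (j - n)"
      using j by (simp flip: wpow_add wpow.simps)
    then have "(x @ wpow w (Suc n)) @ (wpow w (j - n) @ y) = a @ b"
      using ab by simp
    then consider c where "a = x @ wpow w (Suc n) @ c" "wpow w (j - n) @ y = c @ b"
      | c where "x @ wpow w (Suc n) = a @ c" "b = c @ wpow w (j - n) @ y"
      by (elim append_eq_append_cases) auto
    then show "x @ wpow w j @ y \<in> K @@ L"
    proof cases
      case 1
      then have "(x @ wpow w n @ c) @ b \<in> K @@ L"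
        using ab K by (intro concI) auto
      moreover have "wpow w j = wpow w n @ wpow w (j - n)"
        using j by (simp flip: wpow_add)
      ultimately show ?thesis
        using 1 by simp
    next
      case 2
      have "j - n = Suc (j - Suc n)"
        using j by simp
      then have "a @ (c @ wpow w (j - Suc n) @ y) \<in> K @@ L"
        using ab L[of "j - Suc n" c] j 2 by (intro concI) auto
      moreover have "wpow w j = wpow w (Suc n) @ wpow w (j - Suc n)"
        using j by (simp flip: wpow_add wpow.simps)
      ultimately show ?thesis
        using 2 by (metis append_assoc)
    qed
  }
qed

text \<open>All but one of the \<open>k\<close> blocks \<open>wpow u n\<close> on each side are
  moved into \<open>v\<close>; by power idempotency the enlarged word still has the profile of
  \<open>wpow u n\<close>.\<close>

lemma rel_aperiodic_pumps:
  assumes "quot_closed T" "power_idem T n" "rel_aperiodic T n L" "k > 0"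
    and v: "profile T v = profile T (wpow u (k * n))"
  shows "pumps (wpow u (k * n) @ v @ wpow u (k * n)) n L"
proof -
  obtain l where k: "k = Suc l"
    using assms(4) by (cases k) auto
  define v' where "v' = wpow u (l * n) @ v @ wpow u (l * n)"
  have "profile T v' = profile T (wpow u (l * n) @ wpow u (k * n) @ wpow u (l * n))"
    unfolding v'_def using v by (intro profile_append[OF assms(1)]) auto
  also have "\<dots> = profile T (wpow u ((l + k + l) * n))"
    by (simp add: wpow_add add_mult_distrib)
  also have "\<dots> = profile T (wpow u n)"
    using assms(4) by (intro power_idem_mult assms) auto
  finally have "pumps (wpow u n @ v' @ wpow u n) n L"
    using assms(3) by (auto simp: rel_aperiodic_def)
  moreover have "wpow u (k * n) = wpow u n @ wpow u (l * n)" "wpow u (k * n) = wpow u (l * n) @ wpow u n"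
    using wpow_add[of u n "l * n"] wpow_add[of u "l * n" n] k by (simp_all add: add.commute)
  ultimately show ?thesis
    unfolding v'_def by (metis append_assoc)
qed

text \<open>Finer profiles leave fewer pairs \<open>u\<close>, \<open>v\<close> to test. This lets
  two languages share one \<open>T\<close> and one exponent.\<close>

lemma rel_aperiodic_mono:
  assumes "quot_closed T" "power_idem T n" "rel_aperiodic T n L" "T \<subseteq> T'" "k > 0"
  shows "rel_aperiodic T' (k * n) L"
  unfolding rel_aperiodic_def
  using rel_aperiodic_pumps[OF assms(1-3,5)] profile_mono[OF _ assms(4)] pumps_mono assms(5)
  by (metis le_add1 mult.commute mult_Suc_right Suc_pred)

definition has_rel_aperiodic :: "'a list set set \<Rightarrow> 'a list set set \<Rightarrow> bool" where
  "has_rel_aperiodic C \<L> \<longleftrightarrow> (\<exists>T n. finite T \<and> T \<subseteq> C \<and> quot_closed T \<and> power_idem T n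
     \<and> (\<forall>L\<in>\<L>. rel_aperiodic T n L))"

lemma has_rel_aperiodic_Un:
  assumes "has_rel_aperiodic C A" "has_rel_aperiodic C B"
  shows "has_rel_aperiodic C (A \<union> B)"
proof -
  obtain T n where T: "finite T" "T \<subseteq> C" "quot_closed T" "power_idem T n"
    "\<forall>L\<in>A. rel_aperiodic T n L"
    using assms(1) by (auto simp: has_rel_aperiodic_def)
  obtain T' n' where T': "finite T'" "T' \<subseteq> C" "quot_closed T'" "power_idem T' n'"
    "\<forall>L\<in>B. rel_aperiodic T' n' L"
    using assms(2) by (auto simp: has_rel_aperiodic_def)
  have pos: "n > 0" "n' > 0"
    using T T' by (auto simp: power_idem_def)
  have "profile T (wpow u (n' * n + n' * n)) = profile T (wpow u (n' * n))" for u
    using power_idem_mult[OF T(3,4), of "n' + n'"] power_idem_mult[OF T(3,4), of "n'"] pos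
    by (simp add: add_mult_distrib)
  moreover have "profile T' (wpow u (n' * n + n' * n)) = profile T' (wpow u (n' * n))" for u
    using power_idem_mult[OF T'(3,4), of "n + n"] power_idem_mult[OF T'(3,4), of "n"] pos
    by (simp add: add_mult_distrib add_mult_distrib2 mult.commute)
  ultimately have "power_idem (T \<union> T') (n' * n)"
    using pos unfolding power_idem_def profile_eq_iff by auto
  moreover have "rel_aperiodic (T \<union> T') (n' * n) L" if "L \<in> A" for L
    using T pos that by (intro rel_aperiodic_mono[of T]) auto
  moreover have "rel_aperiodic (T \<union> T') (n' * n) L" if "L \<in> B" for L
    using rel_aperiodic_mono[of T' n' L "T \<union> T'" n] T' pos that by (simp add: mult.commute)
  moreover have "quot_closed (T \<union> T')"
    using T(3) T'(3) by (auto simp: quot_closed_def)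
  ultimately show ?thesis
    unfolding has_rel_aperiodic_def using T T' by (intro exI[of _ "T \<union> T'"] exI[of _ "n' * n"]) auto
qed

lemma has_rel_aperiodic_pair:
  assumes "has_rel_aperiodic C {K}" "has_rel_aperiodic C {L}"
  obtains T n where "finite T" "T \<subseteq> C" "quot_closed T" "power_idem T n"
    "rel_aperiodic T n K" "rel_aperiodic T n L"
  using has_rel_aperiodic_Un[OF assms] unfolding has_rel_aperiodic_def by auto

lemma has_rel_aperiodic_SF:
  assumes C: "prevariety C" and "L \<in> SF C"
  shows "has_rel_aperiodic C {L}"
  using assms(2)
proof induction
  case (SF_base L)
  obtain T where T: "finite T" "T \<subseteq> C" "quot_closed T" "L \<in> T"
    using ex_quot_closed[OF C SF_base] .
  obtain n where n: "power_idem T n"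
    using ex_power_idem T by blast
  have "rel_aperiodic T n L"
    unfolding rel_aperiodic_def pumps_def
  proof (intro allI impI)
    fix u v x y j assume v: "profile T v = profile T (wpow u n)" and j: "n \<le> j"
    \<comment> \<open>Since \<open>L\<close> itself belongs to \<open>T\<close>, it suffices that
      all positive powers of \<open>w\<close> have the profile of \<open>wpow u n\<close>.\<close>
    define w where "w = wpow u n @ v @ wpow u n"
    have "profile T w = profile T (wpow u n @ wpow u n @ wpow u n)"
      unfolding w_def using v by (intro profile_append[OF T(3)]) auto
    also have "\<dots> = profile T (wpow u n)"
      using power_idem_mult[OF T(3) n, of 3 u] by (simp add: wpow_add eval_nat_numeral)
    finally have w: "profile T w = profile T (wpow u n)" .
    have "profile T (wpow w i) = profile T (wpow (wpow u n) i)" for i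
    proof (induction i)
      case (Suc i)
      then show ?case
        using profile_append[OF T(3) w] by simp
    qed simp
    then have wi: "profile T (wpow w i) = profile T (wpow u n)" if "i > 0" for i
      using power_idem_mult[OF T(3) n that] by (simp flip: wpow_mult)
    have "n > 0"
      using n by (simp add: power_idem_def)
    then have "profile T (x @ wpow w j @ y) = profile T (x @ wpow w (Suc j) @ y)"
      using wi[of j] wi[of "Suc j"] j by (intro profile_append[OF T(3)]) auto
    then show "x @ wpow (wpow u n @ v @ wpow u n) j @ y \<in> L
      \<longleftrightarrow> x @ wpow (wpow u n @ v @ wpow u n) (Suc j) @ y \<in> L"
      using T(4) unfolding profile_eq_iff w_def by blast
  qed
  then show ?case
    unfolding has_rel_aperiodic_def using T n by blast
next
  case (SF_letter a)
  \<comment> \<open>Here \<open>T\<close> is chosen empty: two copies of a nonempty \<open>w\<close>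
    are already longer than a letter.\<close>
  have "pumps w 2 {[a]}" for w :: "'a list"
  proof (cases "w = []")
    case True
    then have "wpow w j = []" for j
      by (induction j) auto
    then show ?thesis
      using True by (simp add: pumps_def)
  next
    case False
    have "x @ wpow w j @ y \<noteq> [a]" if j: "j \<ge> 2" for x y j
    proof
      assume "x @ wpow w j @ y = [a]"
      moreover obtain i where "j = Suc (Suc i)"
        using j by (metis add_2_eq_Suc le_Suc_ex)
      ultimately have "length (x @ w @ w @ wpow w i @ y) = length [a]"
        by (metis append_assoc wpow.simps(2))
      then show False
        using False by (cases w) auto
    qed
    then show ?thesis
      unfolding pumps_def by (metis le_Suc_eq singletonD)
  qed
  then have "rel_aperiodic {} 2 {[a]}"
    by (simp add: rel_aperiodic_def)
  then show ?case
    unfolding has_rel_aperiodic_def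
    by (intro exI[of _ "{}"] exI[of _ 2]) (auto simp: quot_closed_def power_idem_def profile_def)
next
  case (SF_union K L)
  then obtain T n where T: "finite T" "T \<subseteq> C" "quot_closed T" "power_idem T n"
    "rel_aperiodic T n K" "rel_aperiodic T n L"
    using has_rel_aperiodic_pair by blast
  then have "rel_aperiodic T n (K \<union> L)"
    unfolding rel_aperiodic_def pumps_def by blast
  then show ?case
    unfolding has_rel_aperiodic_def using T by blast
next
  case (SF_compl K)
  then show ?case
    unfolding has_rel_aperiodic_def rel_aperiodic_def pumps_def by simp
next
  case (SF_conc K L)
  then obtain T n where T: "finite T" "T \<subseteq> C" "quot_closed T" "power_idem T n"
    "rel_aperiodic T n K" "rel_aperiodic T n L"
    using has_rel_aperiodic_pair by blast
  have n: "n > 0"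
    using T by (simp add: power_idem_def)
  \<comment> \<open>The exponent \<open>4 * n\<close> is a multiple of \<open>n\<close> that exceeds
    the bound \<open>2 * n + 1\<close> of \<open>pumps_conc\<close>.\<close>
  have "power_idem T (4 * n)"
    using power_idem_mult[OF T(3,4), of 8] power_idem_mult[OF T(3,4), of 4] n
    by (simp add: power_idem_def)
  moreover have "rel_aperiodic T (4 * n) (K @@ L)"
    unfolding rel_aperiodic_def
  proof (intro allI impI)
    fix u v assume "profile T v = profile T (wpow u (4 * n))"
    then have "pumps (wpow u (4 * n) @ v @ wpow u (4 * n)) (2 * n + 1) (K @@ L)"
      using T by (intro pumps_conc rel_aperiodic_pumps[of T]) auto
    then show "pumps (wpow u (4 * n) @ v @ wpow u (4 * n)) (4 * n) (K @@ L)"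
      by (rule pumps_mono) (use n in simp)
  qed
  ultimately show ?case
    unfolding has_rel_aperiodic_def using T by blast
qed

text \<open>In the minimal automaton, relative aperiodicity forbids a counter \<open>v\<close> whose orbit is
  fixed pointwise by some \<open>u\<close> with the same profile.\<close>

lemma rel_aperiodic_counter_free:
  assumes T: "quot_closed T" "power_idem T n" and L: "rel_aperiodic T n L"
    and q: "q \<in> range (\<lambda>x. lquot x L)" and uv: "profile T u = profile T v"
    and fix_u: "\<And>i. lquot (wpow v i @ u) q = lquot (wpow v i) q"
    and k: "k > 0" "lquot (wpow v k) q = q"
  shows "lquot v q = q"
proof -
  obtain x where x: "q = lquot x L"
    using q by blast
  have n: "n > 0"
    using T by (simp add: power_idem_def)
  \<comment> \<open>The middle word is padded with \<open>wpow u (n - 1)\<close> to get the profile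
    of \<open>wpow u n\<close>. All copies of \<open>u\<close> act trivially on the orbit of
    \<open>q\<close>, so \<open>w\<close> moves along it exactly as \<open>v\<close> does.\<close>
  define w where "w = wpow u n @ (v @ wpow u (n - 1)) @ wpow u n"
  have "profile T (v @ wpow u (n - 1)) = profile T (u @ wpow u (n - 1))"
    using uv by (intro profile_append[OF T(1)]) auto
  also have "u @ wpow u (n - 1) = wpow u n"
    using n by (cases n) auto
  finally have "pumps w n L"
    using L unfolding w_def rel_aperiodic_def by blast
  then have pump: "lquot (wpow w n) q = lquot (wpow w (Suc n)) q"
    unfolding pumps_def x by (auto simp: lquot_def)
  have u: "lquot (wpow u j) (lquot (wpow v i) q) = lquot (wpow v i) q" for i j
    using fix_u[of i] by (intro lquot_wpow_id) (simp add: lquot_append)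
  have v_Suc: "lquot v (lquot (wpow v i) q) = lquot (wpow v (Suc i)) q" for i
    using wpow_add[of v i 1] by (simp flip: lquot_append)
  have w_step: "lquot w (lquot (wpow v i) q) = lquot (wpow v (Suc i)) q" for i
    unfolding w_def lquot_append u v_Suc ..
  have w_pow: "lquot (wpow w i) q = lquot (wpow v i) q" for i
  proof (induction i)
    case (Suc i)
    have "lquot (wpow w (Suc i)) q = lquot w (lquot (wpow w i) q)"
      using wpow_add[of w i 1] by (simp flip: lquot_append)
    then show ?case
      using Suc w_step by simp
  qed simp
  have "lquot (wpow v n) q = lquot (wpow v (Suc n)) q"
    using pump w_pow by metis
  \<comment> \<open>Further copies of \<open>v\<close> raise the exponents \<open>n\<close> and
    \<open>Suc n\<close> to \<open>n * k\<close> and \<open>1 + n * k\<close>, where the period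
    \<open>k\<close> applies.\<close>
  then have "lquot (wpow v (k * n - n)) (lquot (wpow v n) q)
      = lquot (wpow v (k * n - n)) (lquot (wpow v (Suc n)) q)"
    by simp
  moreover have "n + (k * n - n) = n * k" "Suc n + (k * n - n) = 1 + n * k"
    using k by (cases k; simp)+
  ultimately have "lquot (wpow v (n * k)) q = lquot (wpow v (1 + n * k)) q"
    by (simp flip: lquot_append wpow_add wpow.simps)
  moreover have kn: "lquot (wpow v (n * k)) q = q"
    using k lquot_wpow_id by (simp add: wpow_mult)
  moreover have "lquot (wpow v (1 + n * k)) q = lquot v (lquot (wpow v (n * k)) q)"
    using v_Suc[of "n * k"] by simp
  ultimately show ?thesis
    by simp
qed


section \<open>From star-free expressions to bounded synchronization delay\<close>

lemma SD_UN:
  assumes "finite I" "\<And>i. i \<in> I \<Longrightarrow> F i \<in> SD C"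
    and "\<And>i j. i \<in> I \<Longrightarrow> j \<in> I \<Longrightarrow> i \<noteq> j \<Longrightarrow> F i \<inter> F j = {}"
  shows "(\<Union>i\<in>I. F i) \<in> SD C"
  using assms
proof (induction rule: finite_induct)
  case (insert i I)
  have "F i \<inter> (\<Union>i\<in>I. F i) = {}"
    using insert.prems(2)[of i] insert.hyps(2) by blast
  then show ?case
    using insert by (auto intro: SD_union)
qed (simp add: SD_empty)

text \<open>Membership of \<open>A\<close> in \<open>SD C\<close> alone is too weak for the
  induction: words must be sorted by their action to form \<open>R\<close> and \<open>P'\<close>.
  Finiteness makes unions of fibres available.\<close>

definition SD_split :: "'a::finite list set set \<Rightarrow> ('a list \<Rightarrow> 'b) \<Rightarrow> 'a list set \<Rightarrow> bool" where
  "SD_split C \<tau> A \<longleftrightarrow> finite (\<tau> ` A) \<and> (\<forall>g. {w \<in> A. \<tau> w = g} \<in> SD C)"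

lemma SD_split_filter:
  assumes "SD_split C \<tau> A"
  shows "{w \<in> A. \<Phi> (\<tau> w)} \<in> SD C"
proof -
  have "(\<Union>g\<in>{g \<in> \<tau> ` A. \<Phi> g}. {w \<in> A. \<tau> w = g}) \<in> SD C"
    using assms by (intro SD_UN) (auto simp: SD_split_def)
  moreover have "(\<Union>g\<in>{g \<in> \<tau> ` A. \<Phi> g}. {w \<in> A. \<tau> w = g}) = {w \<in> A. \<Phi> (\<tau> w)}"
    by auto
  ultimately show ?thesis
    by simp
qed

lemma SD_split_coarsen:
  assumes "SD_split C \<tau> A" "\<And>w. w \<in> A \<Longrightarrow> \<tau>' w = F (\<tau> w)"
  shows "SD_split C \<tau>' A"
  unfolding SD_split_def
proof (intro conjI allI)
  have "\<tau>' ` A = F ` \<tau> ` A"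
    using assms(2) by (auto simp: image_iff)
  then show "finite (\<tau>' ` A)"
    using assms(1) by (simp add: SD_split_def)
  fix g
  have "{w \<in> A. \<tau>' w = g} = {w \<in> A. F (\<tau> w) = g}"
    using assms(2) by auto
  then show "{w \<in> A. \<tau>' w = g} \<in> SD C"
    using SD_split_filter[OF assms(1), of "\<lambda>t. F t = g"] by simp
qed

lemma SD_split_subset:
  assumes "SD_split C \<tau> A"
  shows "SD_split C \<tau> {w \<in> A. \<Phi> (\<tau> w)}"
  unfolding SD_split_def
proof (intro conjI allI)
  show "finite (\<tau> ` {w \<in> A. \<Phi> (\<tau> w)})"
    using assms unfolding SD_split_def by (auto intro: finite_subset[of _ "\<tau> ` A"])
  show "{w \<in> {w \<in> A. \<Phi> (\<tau> w)}. \<tau> w = g} \<in> SD C" for g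
    using SD_split_filter[OF assms, of "\<lambda>t. \<Phi> t \<and> t = g"] by (simp add: conj_assoc)
qed

lemma SD_split_Un:
  assumes "SD_split C \<tau> A" "SD_split C \<tau> B" "A \<inter> B = {}"
  shows "SD_split C \<tau> (A \<union> B)"
  unfolding SD_split_def
proof (intro conjI allI)
  show "finite (\<tau> ` (A \<union> B))"
    using assms by (simp add: SD_split_def image_Un)
  fix g
  have "{w \<in> A. \<tau> w = g} \<union> {w \<in> B. \<tau> w = g} \<in> SD C"
    using assms by (intro SD_union) (auto simp: SD_split_def)
  moreover have "{w \<in> A \<union> B. \<tau> w = g} = {w \<in> A. \<tau> w = g} \<union> {w \<in> B. \<tau> w = g}"
    by auto
  ultimately show "{w \<in> A \<union> B. \<tau> w = g} \<in> SD C"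
    by simp
qed

text \<open>A fibre of \<open>A @@ B\<close> is a finite union of concatenations of fibres, and
  unambiguity makes these disjoint. Separate maps for \<open>A\<close> and \<open>B\<close> allow
  the second factor to act on a smaller state set.\<close>

lemma SD_split_conc:
  assumes A: "SD_split C \<tau>1 A" and B: "SD_split C \<tau>2 B" and "unambiguous A B"
    and F: "\<And>a b. a \<in> A \<Longrightarrow> b \<in> B \<Longrightarrow> \<tau> (a @ b) = F (\<tau>1 a) (\<tau>2 b)"
  shows "SD_split C \<tau> (A @@ B)"
  unfolding SD_split_def
proof (intro conjI allI)
  have fin: "finite (\<tau>1 ` A \<times> \<tau>2 ` B)"
    using A B by (simp add: SD_split_def)
  have "\<tau> ` (A @@ B) \<subseteq> (\<lambda>(s, t). F s t) ` (\<tau>1 ` A \<times> \<tau>2 ` B)"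
    using F by (force elim!: concE)
  then show "finite (\<tau> ` (A @@ B))"
    using fin finite_surj by blast
  fix g
  let ?I = "{p \<in> \<tau>1 ` A \<times> \<tau>2 ` B. F (fst p) (snd p) = g}"
  let ?G = "\<lambda>p. {w \<in> A. \<tau>1 w = fst p} @@ {w \<in> B. \<tau>2 w = snd p}"
  have un: "a = a' \<and> b = b'" if "a \<in> A" "a' \<in> A" "b \<in> B" "b' \<in> B" "a @ b = a' @ b'" for a a' b b'
    using assms(3) that unfolding unambiguous_def by blast
  have "(\<Union>p\<in>?I. ?G p) \<in> SD C"
  proof (rule SD_UN)
    show "finite ?I"
      using fin by simp
    show "?G p \<in> SD C" for p
      using A B un by (intro SD_conc) (auto simp: SD_split_def unambiguous_def)
    show "?G p \<inter> ?G p' = {}" if "p \<noteq> p'" for p p'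
    proof (rule equals0I)
      fix w assume "w \<in> ?G p \<inter> ?G p'"
      then obtain a b a' b' where "a \<in> A" "b \<in> B" "a' \<in> A" "b' \<in> B" "a @ b = a' @ b'"
        "\<tau>1 a = fst p" "\<tau>2 b = snd p" "\<tau>1 a' = fst p'" "\<tau>2 b' = snd p'"
        by (auto simp: conc_def)
      then have "p = p'"
        using un[of a a' b b'] by (simp add: prod_eq_iff)
      then show False
        using that by simp
    qed
  qed
  moreover have "{w \<in> A @@ B. \<tau> w = g} = (\<Union>p\<in>?I. ?G p)"
  proof (intro equalityI subsetI)
    fix w assume "w \<in> {w \<in> A @@ B. \<tau> w = g}"
    then obtain a b where ab: "a \<in> A" "b \<in> B" "w = a @ b" "\<tau> (a @ b) = g"
      by (auto elim: concE)
    then have "(\<tau>1 a, \<tau>2 b) \<in> ?I"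
      using F by auto
    moreover have "w \<in> ?G (\<tau>1 a, \<tau>2 b)"
      using ab by (auto intro: concI)
    ultimately show "w \<in> (\<Union>p\<in>?I. ?G p)"
      by blast
  next
    fix w assume "w \<in> (\<Union>p\<in>?I. ?G p)"
    then show "w \<in> {w \<in> A @@ B. \<tau> w = g}"
      using F by (fastforce elim!: concE intro: concI)
  qed
  ultimately show "{w \<in> A @@ B. \<tau> w = g} \<in> SD C"
    by simp
qed

lemma SD_split_eps: "SD_split (C :: 'a::finite list set set) \<tau> {[]}"
proof -
  have code: "prefix_code ({} :: 'a list set)"
    by (simp add: prefix_code_def)
  have "bounded_sync_delay ({} :: 'a list set)"
    unfolding bounded_sync_delay_def sync_delay_def using code
    by (intro exI[of _ 1]) (simp add: conc_def)
  \<comment> \<open>The language \<open>{[]}\<close> is obtained as the star of the empty prefix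
    code.\<close>
  then have "lstar {} \<in> SD C"
    using code by (intro SD_star SD_empty)
  moreover have "lstar {} = {[] :: 'a list}"
    by (subst lstar_unfold) (simp add: conc_def)
  ultimately have "{[]} \<in> SD C"
    by simp
  moreover have "{w \<in> {[]}. \<tau> w = g} = (if \<tau> [] = g then {[]} else {})" for g
    by auto
  ultimately show ?thesis
    unfolding SD_split_def by (simp add: SD_empty)
qed

text \<open>The restriction makes equality of maps mean equality on \<open>S\<close>, and places the
  actions that preserve a finite \<open>S\<close> in the finite set
  \<open>S \<rightarrow>\<^sub>E S\<close>.\<close>

definition quot_map :: "'a list set set \<Rightarrow> 'a list \<Rightarrow> 'a list set \<Rightarrow> 'a list set" where
  "quot_map S w = restrict (lquot w) S"

lemma quot_map_append:
  "(\<And>q. q \<in> S \<Longrightarrow> lquot a q \<in> S') \<Longrightarrow> quot_map S (a @ b) = compose S (quot_map S' b) (quot_map S a)"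
  by (auto simp: quot_map_def compose_def lquot_append fun_eq_iff)

lemma quot_map_eq_iff: "quot_map S u = quot_map S v \<longleftrightarrow> (\<forall>q\<in>S. lquot u q = lquot v q)"
  by (auto simp: quot_map_def fun_eq_iff)

lemma lquot_lstar_stable:
  assumes "w \<in> lstar P" "\<And>w q. w \<in> P \<Longrightarrow> q \<in> S \<Longrightarrow> lquot w q \<in> S" "q \<in> S"
  shows "lquot w q \<in> S"
  using assms(1,3) by (induction arbitrary: q rule: lstar_induct) (auto simp: lquot_append assms(2))

text \<open>By pigeonhole two powers \<open>i < j\<close> of \<open>u\<close> act alike on
  \<open>S\<close>; cancelling the injective action of \<open>wpow u i\<close> leaves the identity
  for \<open>j - i\<close>.\<close>

lemma wpow_permutation:
  assumes "finite S" "\<And>q. q \<in> S \<Longrightarrow> lquot u q \<in> S" "inj_on (lquot u) S"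
  obtains m where "m > 0" "\<And>q. q \<in> S \<Longrightarrow> lquot (wpow u m) q = q"
proof -
  have st: "lquot (wpow u i) q \<in> S" if "q \<in> S" for i q
    using that by (induction i arbitrary: q) (auto simp: lquot_append assms(2))
  have inj: "inj_on (lquot (wpow u i)) S" for i
  proof (induction i)
    case (Suc i)
    then show ?case
      using assms(2,3) by (auto simp: inj_on_def lquot_append)
  qed (simp add: inj_on_def)
  have "range (\<lambda>i. quot_map S (wpow u i)) \<subseteq> S \<rightarrow>\<^sub>E S"
    using st by (auto simp: quot_map_def)
  then have "finite (range (\<lambda>i. quot_map S (wpow u i)))"
    using assms(1) by (meson finite_PiE finite_subset)
  then have "\<not> inj (\<lambda>i. quot_map S (wpow u i))"
    using finite_imageD infinite_UNIV_nat by blast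
  then obtain i j where ij: "i < j" "quot_map S (wpow u i) = quot_map S (wpow u j)"
    unfolding inj_on_def by (metis linorder_neqE_nat)
  show ?thesis
  proof
    show "j - i > 0"
      using ij by simp
    fix q assume q: "q \<in> S"
    have "lquot (wpow u i) (lquot (wpow u (j - i)) q) = lquot (wpow u j) q"
      using ij by (simp flip: lquot_append wpow_add)
    also have "\<dots> = lquot (wpow u i) q"
      using ij q by (simp add: quot_map_eq_iff)
    finally show "lquot (wpow u (j - i)) q = q"
      by (rule inj_onD[OF inj]) (use q st in auto)
  qed
qed

text \<open>Abstracts from profiles and the minimal automaton: later \<open>h\<close> is
  \<open>profile T\<close> and \<open>States\<close> is the set of left quotients of
  \<open>L\<close>. The use of \<open>C\<close> enters through \<open>saturated\<close>, and
  relative aperiodicity enters through \<open>no_counter\<close>.\<close>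

locale counter_free =
  fixes C :: "'a::finite list set set" and h :: "'a list \<Rightarrow> 'b" and States :: "'a list set set"
  assumes saturated: "\<And>W. (\<And>u v. h u = h v \<Longrightarrow> u \<in> W \<Longrightarrow> v \<in> W) \<Longrightarrow> W \<in> C"
    and cong: "\<And>u v x. h u = h v \<Longrightarrow> h (x @ u) = h (x @ v)"
    and no_counter: "\<And>q u v k. q \<in> States \<Longrightarrow> h u = h v
      \<Longrightarrow> (\<And>i. lquot (wpow v i @ u) q = lquot (wpow v i) q)
      \<Longrightarrow> k > 0 \<Longrightarrow> lquot (wpow v k) q = q \<Longrightarrow> lquot v q = q"
begin

text \<open>Some \<open>wpow u m\<close> is the identity on \<open>S\<close>, and it has the same
  \<open>h\<close> as \<open>v' = wpow u (m - 1) @ v\<close>, which acts as the inverse of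
  \<open>u\<close> followed by \<open>v\<close>. By \<open>no_counter\<close>, \<open>v'\<close>
  also acts as the identity.\<close>

lemma permutations_determined:
  assumes S: "finite S" "S \<subseteq> States"
    and u: "\<And>q. q \<in> S \<Longrightarrow> lquot u q \<in> S" "inj_on (lquot u) S"
    and v: "\<And>q. q \<in> S \<Longrightarrow> lquot v q \<in> S" "inj_on (lquot v) S"
    and "h u = h v" "q \<in> S"
  shows "lquot u q = lquot v q"
proof -
  obtain m where m: "m > 0" "\<And>q. q \<in> S \<Longrightarrow> lquot (wpow u m) q = q"
    using wpow_permutation[OF S(1) u] by blast
  have um: "wpow u m = wpow u (m - 1) @ u" "wpow u m = u @ wpow u (m - 1)"
    using wpow_add[of u "m - 1" 1] wpow_add[of u 1 "m - 1"] m(1) by simp_all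
  define v' where "v' = wpow u (m - 1) @ v"
  have h: "h (wpow u m) = h v'"
    unfolding v'_def um(1) using cong assms(7) by blast
  have st: "lquot (wpow u i) q \<in> S" if "q \<in> S" for i q
    using that by (induction i arbitrary: q) (auto simp: lquot_append u)
  have st': "lquot v' q \<in> S" if "q \<in> S" for q
    using st v that by (simp add: v'_def lquot_append)
  have "inj_on (lquot (wpow u (m - 1))) S"
  proof (rule inj_on_inverseI)
    fix q assume "q \<in> S"
    then show "lquot u (lquot (wpow u (m - 1)) q) = q"
      using m(2) um(1) by (simp flip: lquot_append)
  qed
  moreover have "inj_on (lquot v) (lquot (wpow u (m - 1)) ` S)"
    by (rule inj_on_subset[OF v(2)]) (use st in blast)
  ultimately have "inj_on (lquot v \<circ> lquot (wpow u (m - 1))) S"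
    by (rule comp_inj_on)
  moreover have "lquot v \<circ> lquot (wpow u (m - 1)) = lquot v'"
    by (rule ext) (simp add: v'_def lquot_append)
  ultimately have inj': "inj_on (lquot v') S"
    by simp
  obtain k where k: "k > 0" "\<And>q. q \<in> S \<Longrightarrow> lquot (wpow v' k) q = q"
    using wpow_permutation[OF S(1) st' inj'] by blast
  have stv: "lquot (wpow v' i) q \<in> S" if "q \<in> S" for i q
    using that by (induction i arbitrary: q) (auto simp: lquot_append st')
  have id: "lquot v' q = q" if q: "q \<in> S" for q
  proof (rule no_counter[OF _ h _ k(1)])
    show "q \<in> States"
      using q S by blast
    show "lquot (wpow v' i @ wpow u m) q = lquot (wpow v' i) q" for i
      using m(2) stv q by (simp add: lquot_append)
    show "lquot (wpow v' k) q = q"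
      using k q by blast
  qed
  have "lquot v q = lquot v (lquot (wpow u m) q)"
    using m \<open>q \<in> S\<close> by simp
  also have "\<dots> = lquot v' (lquot u q)"
    unfolding um(2) v'_def by (simp add: lquot_append)
  also have "\<dots> = lquot u q"
    using id u \<open>q \<in> S\<close> by blast
  finally show ?thesis
    by simp
qed

text \<open>Within \<open>lstar P\<close> the value of \<open>h\<close> fixes the action, by
  \<open>permutations_determined\<close>; so each fibre is cut out of \<open>lstar P\<close> by one
  \<open>h\<close>-saturated language \<open>W\<close>, which lies in \<open>C\<close>.\<close>

lemma SD_split_lstar_permutations:
  assumes S: "finite S" "S \<subseteq> States" and P: "bounded_sync_delay P"
    and stable: "\<And>w q. w \<in> P \<Longrightarrow> q \<in> S \<Longrightarrow> lquot w q \<in> S"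
    and inj: "\<And>w. w \<in> P \<Longrightarrow> inj_on (lquot w) S"
    and split: "SD_split C (quot_map S) P"
  shows "SD_split C (quot_map S) (lstar P)"
  unfolding SD_split_def
proof (intro conjI allI)
  have st: "lquot w q \<in> S" if "w \<in> lstar P" "q \<in> S" for w q
    using lquot_lstar_stable that stable by blast
  have "quot_map S ` lstar P \<subseteq> S \<rightarrow>\<^sub>E S"
    using st by (auto simp: quot_map_def)
  then show "finite (quot_map S ` lstar P)"
    using S(1) by (meson finite_PiE finite_subset)
  have inj': "inj_on (lquot w) S" if "w \<in> lstar P" for w
    using that
  proof (induction rule: lstar_induct)
    case (Cons k x)
    then show ?case
      using inj[of k] stable[of k] by (auto simp: inj_on_def lquot_append)
  qed (simp add: inj_on_def)
  fix g
  define W where "W = {v. \<exists>u\<in>lstar P. quot_map S u = g \<and> h u = h v}"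
  have "W \<in> C"
    by (rule saturated) (auto simp: W_def)
  moreover have "P \<in> SD C"
    using SD_split_filter[OF split, of "\<lambda>_. True"] by simp
  then have "lstar P \<in> SD C"
    using P by (intro SD_star) (auto simp: bounded_sync_delay_def sync_delay_def)
  ultimately have "lstar P \<inter> W \<in> SD C"
    by (intro SD_inter)
  moreover have "quot_map S v = g" if "v \<in> lstar P" "u \<in> lstar P" "quot_map S u = g" "h u = h v" for u v
    using permutations_determined[OF S, of u v] st inj' that by (auto simp: quot_map_eq_iff)
  then have "{w \<in> lstar P. quot_map S w = g} = lstar P \<inter> W"
    by (auto simp: W_def)
  ultimately show "{w \<in> lstar P. quot_map S w = g} \<in> SD C"
    by simp
qed

text \<open>The decomposition is that of \<open>lstar_return_words\<close>. One return word takes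
  \<open>S\<close> into \<open>S'\<close>, so on \<open>S\<close> the star of the return words is
  treated as the empty word or a return word followed by a star that acts on \<open>S'\<close> only.
  The assumption \<open>Q\<close> is an implication because its premise is established inside the
  proof, while its conclusion comes from the induction.\<close>

lemma SD_split_lstar_step:
  assumes P: "sync_delay P d" "P = P' \<union> R" "P' \<inter> R = {}"
    and stable: "\<And>w q. w \<in> P \<Longrightarrow> q \<in> S \<Longrightarrow> lquot w q \<in> S"
    and S': "S' \<subseteq> S" "\<And>w q. w \<in> R \<Longrightarrow> q \<in> S \<Longrightarrow> lquot w q \<in> S'"
    and R: "SD_split C (quot_map S) R"
    and P': "SD_split C (quot_map S) (lstar P')"
    and Q: "SD_split C (quot_map S') (lstar P' @@ R) \<Longrightarrow> SD_split C (quot_map S') (lstar (lstar P' @@ R))"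
  shows "SD_split C (quot_map S) (lstar P)"
proof -
  let ?Q = "lstar P' @@ R"
  have pc: "prefix_code P"
    using P(1) by (simp add: sync_delay_def)
  have sub: "P' \<subseteq> P" "R \<subseteq> P"
    using P(2) by auto
  have codeQ: "prefix_code ?Q"
    using prefix_code_return_words[OF pc sub P(3)] .
  have stP': "lquot w q \<in> S" if "w \<in> lstar P'" "q \<in> S" for w q
    using lquot_lstar_stable[OF that(1)] stable sub that(2) by blast
  have stQ: "lquot w q \<in> S'" if "w \<in> ?Q" "q \<in> S" for w q
    using that stP' S' by (auto simp: lquot_append elim!: concE)
  have stQ': "lquot w q \<in> S" if "w \<in> lstar ?Q" "q \<in> S" for w q
    using lquot_lstar_stable[OF that(1)] stQ S'(1) that(2) by blast
  have QS: "SD_split C (quot_map S) ?Q"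
    by (rule SD_split_conc[OF P' R unambiguous_return_words[OF pc sub P(3)]])
      (rule quot_map_append, rule stP')
  have "quot_map S' w = restrict (quot_map S w) S'" for w
    using S'(1) by (auto simp: quot_map_def fun_eq_iff)
  then have "SD_split C (quot_map S') ?Q"
    by (intro SD_split_coarsen[OF QS])
  then have QS': "SD_split C (quot_map S') (lstar ?Q)"
    by (rule Q)
  have "SD_split C (quot_map S) (?Q @@ lstar ?Q)"
    by (rule SD_split_conc[OF QS QS' unambiguous_prefix_code[OF codeQ]])
      (rule quot_map_append, rule stQ)
  moreover have "{[]} \<inter> ?Q @@ lstar ?Q = {}"
    using prefix_code_Nil[OF codeQ] by (auto simp: conc_def)
  ultimately have "SD_split C (quot_map S) (lstar ?Q)"
    by (subst lstar_unfold) (intro SD_split_Un SD_split_eps)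
  moreover have "unambiguous (lstar ?Q) (lstar P')"
    using return_word_not_prefix[OF pc sub P(3)]
    by (intro unambiguous_lstar[OF codeQ]) (auto elim!: concE)
  ultimately have "SD_split C (quot_map S) (lstar ?Q @@ lstar P')"
    by (rule SD_split_conc[OF _ P']) (rule quot_map_append, rule stQ')
  then show ?thesis
    using lstar_return_words[OF P(2)] by simp
qed

lemma SD_split_lstar:
  assumes "finite S" "S \<subseteq> States" "bounded_sync_delay P"
    and "\<And>w q. w \<in> P \<Longrightarrow> q \<in> S \<Longrightarrow> lquot w q \<in> S"
    and "SD_split C (quot_map S) P"
  shows "SD_split C (quot_map S) (lstar P)"
  using assms
\<comment> \<open>The order is lexicographic: first the number of states, then the number of
  distinct actions of words of \<open>P\<close>.\<close>
proof (induction "(S, P)" arbitrary: S P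
    rule: wf_induct_rule[OF wf_measures[of "[\<lambda>(S, P). card S, \<lambda>(S, P). card (quot_map S ` P)]"]])
  case (1 S P)
  show ?case
  proof (cases "\<forall>w\<in>P. inj_on (lquot w) S")
    case True
    then show ?thesis
      using 1 by (intro SD_split_lstar_permutations) auto
  next
    case False
    then obtain r where r: "r \<in> P" "\<not> inj_on (lquot r) S"
      by blast
    \<comment> \<open>A whole fibre is removed: \<open>P'\<close> then has one action fewer on the
      same \<open>S\<close>, while the return words act on the image \<open>S'\<close>, which is
      smaller than \<open>S\<close> because \<open>r\<close> is not injective.\<close>
    define R where "R = {w \<in> P. quot_map S w = quot_map S r}"
    define P' where "P' = {w \<in> P. quot_map S w \<noteq> quot_map S r}"
    define S' where "S' = lquot r ` S"
    obtain d where d: "sync_delay P d"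
      using 1(4) by (auto simp: bounded_sync_delay_def)
    have P: "P = P' \<union> R" "P' \<inter> R = {}"
      by (auto simp: P'_def R_def)
    have R': "lquot w q \<in> S'" if "w \<in> R" "q \<in> S" for w q
      using that by (auto simp: R_def S'_def quot_map_eq_iff)
    have S': "S' \<subseteq> S"
      using 1(5) r by (auto simp: S'_def)
    show ?thesis
    proof (rule SD_split_lstar_step[OF d P 1(5) S' R'])
      show "SD_split C (quot_map S) R"
        unfolding R_def by (rule SD_split_subset[OF 1(6)])
      have "quot_map S r \<in> quot_map S ` P" "quot_map S r \<notin> quot_map S ` P'"
        using r(1) by (auto simp: P'_def)
      then have "quot_map S ` P' \<subset> quot_map S ` P"
        using P(1) by blast
      then have "card (quot_map S ` P') < card (quot_map S ` P)"
        using 1(6) by (intro psubset_card_mono) (auto simp: SD_split_def)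
      moreover have "sync_delay P' d"
        using sync_delay_subset[OF d] P by blast
      then have "bounded_sync_delay P'"
        by (rule sync_delay_bounded)
      moreover have "SD_split C (quot_map S) P'"
        unfolding P'_def by (rule SD_split_subset[OF 1(6)])
      ultimately show P'_split: "SD_split C (quot_map S) (lstar P')"
        using 1(2,3,5) P by (intro 1(1)) auto
      have "card S' < card S"
        using r(2) 1(2) card_image_le[of S "lquot r"] inj_on_iff_eq_card[of S "lquot r"]
        unfolding S'_def by linarith
      moreover have "sync_delay (lstar P' @@ R) (Suc d)"
        using sync_delay_return_words[OF d P] .
      then have "bounded_sync_delay (lstar P' @@ R)"
        by (rule sync_delay_bounded)
      moreover have "lquot w q \<in> S'" if wq: "w \<in> lstar P' @@ R" "q \<in> S'" for w q
      proof -
        obtain a b where ab: "a \<in> lstar P'" "b \<in> R" "w = a @ b"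
          using wq(1) by (rule concE)
        have "lquot a q \<in> S"
          by (rule lquot_lstar_stable[OF ab(1)]) (use 1(5) P(1) S' wq(2) in auto)
        then show ?thesis
          using ab R' by (simp add: lquot_append)
      qed
      moreover assume "SD_split C (quot_map S') (lstar P' @@ R)"
      ultimately show "SD_split C (quot_map S') (lstar (lstar P' @@ R))"
        using 1(2,3) S' finite_subset by (intro 1(1)) auto
    qed
  qed
qed

end

section \<open>The alphabet as a code and the second inclusion\<close>

lemma lstar_letters: "lstar (range (\<lambda>a. [a])) = UNIV"
proof -
  have "w \<in> lstar (range (\<lambda>a. [a]))" for w
  proof (induction w)
    case (Cons a w)
    then show ?case
      using lstar_Cons[of "[a]" "range (\<lambda>a. [a])" w] by auto
  qed auto
  then show ?thesis
    by blast
qed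

lemma letters_sync_delay: "sync_delay (range (\<lambda>a::'a. [a])) 1"
  unfolding sync_delay_def
proof (intro conjI allI impI)
  show code: "prefix_code (range (\<lambda>a::'a. [a]))"
    by (rule prefix_codeI) auto
  fix u v w :: "'a list"
  assume "u @ v @ w \<in> lplus (range (\<lambda>a. [a])) \<and> v \<in> lpow (range (\<lambda>a. [a])) 1"
  then have "v \<noteq> []"
    by (auto simp: conc_def)
  then show "u @ v \<in> lplus (range (\<lambda>a. [a]))"
    using code by (simp add: lplus_eq_lstar lstar_letters)
qed simp

lemma SF_subset_SD:
  assumes C: "prevariety C" and L: "L \<in> SF C"
  shows "L \<in> SD C"
proof -
  obtain T n where T: "finite T" "T \<subseteq> C" "quot_closed T" "power_idem T n" "rel_aperiodic T n L"
    using has_rel_aperiodic_SF[OF C L] by (auto simp: has_rel_aperiodic_def)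
  \<comment> \<open>These are the states of the minimal automaton of \<open>L\<close>.\<close>
  define S where "S = range (\<lambda>u. lquot u L)"
  interpret counter_free C "profile T" S
  proof
    show "W \<in> C" if "\<And>u v. profile T u = profile T v \<Longrightarrow> u \<in> W \<Longrightarrow> v \<in> W" for W
      using profile_saturated[OF C T(1,2)] that by blast
    show "profile T (x @ u) = profile T (x @ v)" if "profile T u = profile T v" for u v x
      using profile_append[OF T(3)] that by blast
    show "lquot v q = q" if "q \<in> S" "profile T u = profile T v"
      "\<And>i. lquot (wpow v i @ u) q = lquot (wpow v i) q" "k > 0" "lquot (wpow v k) q = q" for q u v k
      using rel_aperiodic_counter_free[OF T(3-5) _ that(2-5)] that(1) by (simp add: S_def)
  qed
  have "{w \<in> range (\<lambda>a. [a]). quot_map S w = g} \<in> SD C" for g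
  proof -
    have "(\<Union>a\<in>{a. quot_map S [a] = g}. {[a]}) \<in> SD C"
      by (intro SD_UN SD_letter) auto
    moreover have "(\<Union>a\<in>{a. quot_map S [a] = g}. {[a]}) = {w \<in> range (\<lambda>a. [a]). quot_map S w = g}"
      by auto
    ultimately show ?thesis
      by simp
  qed
  then have "SD_split C (quot_map S) (range (\<lambda>a. [a]))"
    by (simp add: SD_split_def)
  moreover have "finite S"
    using finite_lquot_SF[OF C L] by (simp add: S_def)
  moreover have "lquot w q \<in> S" if "q \<in> S" for w q
    using that by (auto simp: S_def simp flip: lquot_append)
  ultimately have "SD_split C (quot_map S) (lstar (range (\<lambda>a. [a])))"
    using sync_delay_bounded[OF letters_sync_delay] by (intro SD_split_lstar) auto
  \<comment> \<open>A word lies in \<open>L\<close> iff the quotient of \<open>L\<close> by it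
    contains the empty word, so \<open>L\<close> is a union of fibres of the action on
    \<open>S\<close>.\<close>
  then have "{w \<in> UNIV. [] \<in> quot_map S w L} \<in> SD C"
    unfolding lstar_letters by (rule SD_split_filter)
  moreover have "L \<in> S"
    unfolding S_def using lquot_Nil by (metis rangeI)
  then have "{w \<in> UNIV. [] \<in> quot_map S w L} = L"
    by (auto simp: quot_map_def) (auto simp: lquot_def)
  ultimately show ?thesis
    by simp
qed

theorem theorem4p10:
  fixes C :: "('a::finite) list set set"
  assumes "prevariety C"
  shows "SD C = SF C"
  using SD_subset_SF[OF assms] SF_subset_SD[OF assms] by blast

end
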